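(* Let $\Gamma$ be a finite tape alphabet with $|\Gamma|\ge2$ containing a blank symbol $\Box$, and let $\sigma_\Box:\mathbb Z\to\Gamma$ be the constant function with value $\Box$. For every tape automaton $m$ over input alphabet $A_\tau=A\cup\{\tau\}$ and tape alphabet $\Gamma$, and every state $x$, the language $\{w\in A^*\mid \llbracket x\rrbracket^\tau_m(w)(0,\sigma_\Box)=1\}$ is recursively enumerable. Conversely, every recursively enumerable language $\mathcal L\subseteq A^*$ is of this form for some such tape automaton $m$ and state $x$.
   Context: Notation: $\sigma=_{i\pm k}\sigma'$ iff $\sigma(j)=\sigma'(j)$ for all $|i-j|\le k$; $\sigma=^{i\pm k}\sigma'$ iff $\sigma(j)=\sigma'(j)$ for all $|i-j|>k$; $\sigma_{+j}=\sigma\circ(\lambda i.i+j)$. Tape monad: $TX$ is the set of $\langle r,z,t\rangle:\mathbb Z\times\Gamma^{\mathbb Z}\to X\times\mathbb Z\times\Gamma^{\mathbb Z}$ for which there is $k\ge0$ such that for all $i,j\in\mathbb Z$ and $\sigma=_{i\pm k}\sigma'$: $t(i,\sigma)=_{i\pm k}t(i,\sigma')$, $r(i,\sigma)=r(i,\sigma')$, $|z(i,\sigma)-i|\le k$, $t(i,\sigma)=^{i\pm k}\sigma$, $z(i,\sigma)=z(i,\sigma')$, $t(i,\sigma_{+j})=t(i+j,\sigma)_{+j}$, $r(i,\sigma_{+j})=r(i+j,\sigma)$, $z(i,\sigma_{+j})=z(i+j,\sigma)-j$; unit $\eta(x)(i,\sigma)=(x,i,\sigma)$, Kleisli $f^\dagger(\langle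 r,z,t\rangle)(i,\sigma)=f(r(i,\sigma))(z(i,\sigma),t(i,\sigma))$. A tape automaton over $A_\tau$ is a finite set $X$ with maps $o^m:X\to B$, $t^m:A_\tau\times X\to TX$, where $B$ is the set of $p\in2^{\mathbb Z\times\Gamma^{\mathbb Z}}$ for which there is $k$ with $p(i,\sigma)=p(i,\sigma')$ whenever $\sigma=_{i\pm k}\sigma'$ and $p(i,\sigma_{+j})=p(i+j,\sigma)$, with $\mathbb T$-algebra $a^m(\langle r,z,t\rangle)(i,\sigma)=r(i,\sigma)(z(i,\sigma),t(i,\sigma))$; $B$ is an $\omega$-additive monoid under pointwise (countable) disjunction. Observational semantics: let $T_BX=B^{(B^X)}$ be the continuation monad, $\kappa_X(p)=\lambda f.a^m(Tf(p))$, $t^{m_*}=\kappa_X\circ t^m$, $o^{m_*}=o^m$; $T_BX$ is $\omega$-additive pointwise. Define the $\mathbb T_B$-automaton $m_v$ over $A$ with $a^{m_v}(k)=k(\mathrm{id})$, $t^{m_v}(x_0,a)=\sum_{i\ge1}\mathsf{do}\ x_1\leftarrow t^{m_*}(x_0,\tau);\dots;x_{i-1}\leftarrow t^{m_*}(x_{i-2},\tau);\ t^{m_*}(x_{i-1},a)$ and $o^{m_v}(x_0)=o^{m_*}(x_0)+\sum_{i\ge1}\big(\mathsf{do}\ x_1\leftarrow t^{m_*}(x_0,\tau);\dots;\ t^{m_*}(x_{i-1},\tau)\big)(o^{m_*})$, where $\mathsf{do}\ y\leftarrow q;\ g(y)$ means $g^\dagger(q)$ in $\mathbb T_B$. Then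 $\llbracket x\rrbracket^\tau_m=\llbracket x\rrbracket_{m_v}$, the trace semantics of $m_v$: $\llbracket x\rrbracket_{m_v}(\epsilon)=o^{m_v}(x)$, $\llbracket x\rrbracket_{m_v}(au)=a^{m_v}\big(\mathsf{do}\ y\leftarrow t^{m_v}(x,a);\ \eta(\llbracket y\rrbracket_{m_v}(u))\big)$. *)

theory Defs
  imports Main "HOL-Library.Cardinality"
begin

type_synonym 'g tape = "int \<Rightarrow> 'g"

definition eq_near :: "int \<Rightarrow> nat \<Rightarrow> 'g tape \<Rightarrow> 'g tape \<Rightarrow> bool" where
  "eq_near i k s s' \<longleftrightarrow> (\<forall>j. \<bar>i - j\<bar> \<le> int k \<longrightarrow> s j = s' j)"

definition eq_far :: "int \<Rightarrow> nat \<Rightarrow> 'g tape \<Rightarrow> 'g tape \<Rightarrow> bool" where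
  "eq_far i k s s' \<longleftrightarrow> (\<forall>j. \<bar>i - j\<bar> > int k \<longrightarrow> s j = s' j)"

definition shift :: "'g tape \<Rightarrow> int \<Rightarrow> 'g tape" where
  "shift s j = s \<circ> (\<lambda>i. i + j)"

(* an element <r,z,t> of T X, written as a single function (i,sigma) |-> (r,z,t) *)
type_synonym ('x, 'g) tcomp = "int \<Rightarrow> 'g tape \<Rightarrow> 'x \<times> int \<times> 'g tape"

definition tloc :: "nat \<Rightarrow> ('x, 'g) tcomp \<Rightarrow> bool" where
  "tloc k p \<longleftrightarrow>
    (\<forall>i j s s'. eq_near i k s s' \<longrightarrow>
        eq_near i k (snd (snd (p i s))) (snd (snd (p i s')))
      \<and> fst (p i s) = fst (p i s')
      \<and> \<bar>fst (snd (p i s)) - i\<bar> \<le> int k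
      \<and> eq_far i k (snd (snd (p i s))) s
      \<and> fst (snd (p i s)) = fst (snd (p i s'))
      \<and> snd (snd (p i (shift s j))) = shift (snd (snd (p (i + j) s))) j
      \<and> fst (p i (shift s j)) = fst (p (i + j) s)
      \<and> fst (snd (p i (shift s j))) = fst (snd (p (i + j) s)) - j)"

definition TX :: "'x set \<Rightarrow> ('x, 'g) tcomp set" where
  "TX X = {p. (\<exists>k. tloc k p) \<and> (\<forall>i s. fst (p i s) \<in> X)}"

type_synonym 'g obs = "int \<Rightarrow> 'g tape \<Rightarrow> bool"

definition Bset :: "'g obs set" where
  "Bset = {p. \<exists>k. (\<forall>i s s'. eq_near i k s s' \<longrightarrow> p i s = p i s')
                 \<and> (\<forall>i j s. p i (shift s j) = p (i + j) s)}"

(* tape automaton over A_tau = 'a option (None = tau) with tape alphabet 'g,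
   state set X, output map o and transition map t *)
definition tape_automaton ::
  "'x set \<Rightarrow> ('x \<Rightarrow> 'g obs) \<Rightarrow> ('x \<Rightarrow> 'a option \<Rightarrow> ('x, 'g) tcomp) \<Rightarrow> bool" where
  "tape_automaton X out tr \<longleftrightarrow> finite X \<and> (\<forall>x\<in>X. out x \<in> Bset)
      \<and> (\<forall>x\<in>X. \<forall>a. tr x a \<in> TX X)"

type_synonym ('x, 'g) cont = "('x \<Rightarrow> 'g obs) \<Rightarrow> 'g obs"

definition ceta :: "'x \<Rightarrow> ('x, 'g) cont" where
  "ceta x = (\<lambda>k. k x)"

definition cbind :: "('x, 'g) cont \<Rightarrow> ('x \<Rightarrow> ('y, 'g) cont) \<Rightarrow> ('y, 'g) cont" where
  "cbind q g = (\<lambda>k. q (\<lambda>y. g y k))"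

(* kappa_X(p) = \<lambda>f. a^m(T f (p)) *)
definition kappa :: "('x, 'g) tcomp \<Rightarrow> ('x, 'g) cont" where
  "kappa p = (\<lambda>f i s. case p i s of (x, j, s') \<Rightarrow> f x j s')"

definition tstar :: "('x \<Rightarrow> 'a option \<Rightarrow> ('x, 'g) tcomp) \<Rightarrow> 'x \<Rightarrow> 'a option \<Rightarrow> ('x, 'g) cont" where
  "tstar tr x a = kappa (tr x a)"

primrec tauchain :: "('x \<Rightarrow> 'a option \<Rightarrow> ('x, 'g) tcomp) \<Rightarrow> nat \<Rightarrow> 'x \<Rightarrow> ('x, 'g) cont" where
  "tauchain tr 0 = ceta"
| "tauchain tr (Suc n) = (\<lambda>x. cbind (tstar tr x None) (tauchain tr n))"

(* t^{m_v}(x0,a): countable pointwise disjunction over i >= 1 (n = i - 1 tau-steps) *)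
definition tv :: "('x \<Rightarrow> 'a option \<Rightarrow> ('x, 'g) tcomp) \<Rightarrow> 'x \<Rightarrow> 'a \<Rightarrow> ('x, 'g) cont" where
  "tv tr x a = (\<lambda>k i s. \<exists>n. cbind (tauchain tr n x) (\<lambda>y. tstar tr y (Some a)) k i s)"

definition ov :: "('x \<Rightarrow> 'g obs) \<Rightarrow> ('x \<Rightarrow> 'a option \<Rightarrow> ('x, 'g) tcomp) \<Rightarrow> 'x \<Rightarrow> 'g obs" where
  "ov out tr x = (\<lambda>i s. out x i s \<or> (\<exists>n\<ge>1. tauchain tr n x out i s))"

definition av :: "('g obs, 'g) cont \<Rightarrow> 'g obs" where
  "av k = k id"

(* trace semantics [[x]]_{m_v} = [[x]]^tau_m *)
primrec obs_sem :: "('x \<Rightarrow> 'g obs) \<Rightarrow> ('x \<Rightarrow> 'a option \<Rightarrow> ('x, 'g) tcomp) \<Rightarrow> 'a list \<Rightarrow> 'x \<Rightarrow> 'g obs" where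
  "obs_sem out tr [] = ov out tr"
| "obs_sem out tr (a # u) =
     (\<lambda>x. av (cbind (tv tr x a) (\<lambda>y. ceta (obs_sem out tr u y))))"

(* tape symbols: Inl a (input letters) or Inr n (work symbols; Inr 0 is the blank).
   A machine has states {..<Q}, start state 0, work symbols {Inr 0..Inr S},
   partial transition function delta (None = halt), moves in {-1,0,1}. *)
type_synonym 'a tm = "nat \<Rightarrow> ('a + nat) \<Rightarrow> (nat \<times> ('a + nat) \<times> int) option"

definition tm_wf :: "nat \<Rightarrow> nat \<Rightarrow> 'a tm \<Rightarrow> bool" where
  "tm_wf Q S \<delta> \<longleftrightarrow> 0 < Q \<and>
     (\<forall>q s q' s' d. q < Q \<and> \<delta> q s = Some (q', s', d) \<longrightarrow>
        q' < Q \<and> s' \<in> range Inl \<union> Inr ` {..S} \<and> d \<in> {-1, 0, 1})"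

definition tm_input :: "'a list \<Rightarrow> int \<Rightarrow> 'a + nat" where
  "tm_input w = (\<lambda>i. if 0 \<le> i \<and> i < int (length w) then Inl (w ! nat i) else Inr 0)"

definition tm_step :: "'a tm \<Rightarrow> nat \<times> int \<times> (int \<Rightarrow> 'a + nat) \<Rightarrow> nat \<times> int \<times> (int \<Rightarrow> 'a + nat)" where
  "tm_step \<delta> c = (case c of (q, h, tp) \<Rightarrow>
     (case \<delta> q (tp h) of None \<Rightarrow> (q, h, tp)
      | Some (q', s', d) \<Rightarrow> (q', h + d, tp(h := s'))))"

definition tm_halts :: "'a tm \<Rightarrow> 'a list \<Rightarrow> bool" where
  "tm_halts \<delta> w \<longleftrightarrow> (\<exists>n. case (tm_step \<delta> ^^ n) (0, 0, tm_input w) of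
                             (q, h, tp) \<Rightarrow> \<delta> q (tp h) = None)"

definition RE :: "'a list set \<Rightarrow> bool" where
  "RE L \<longleftrightarrow> (\<exists>Q S \<delta>. tm_wf Q S \<delta> \<and> L = {w. tm_halts \<delta> w})"

end

(* Both directions go through runs indexed by choice strings: the observational semantics accepts a
   word iff some string over {silent step, consume a letter} drives the automaton to an accepting
   configuration with the input exhausted.

   Given a tape automaton, a deterministic machine with six stacks tries all choice strings in turn,
   keeping the tape as a window around the head (in the finite control) between two stacks; locality
   and shift invariance make each automaton step computable from the window. The stacks are then
   tracks of a Turing machine tape.

   Given a Turing machine, a tape automaton stores each machine symbol in a block of cells. It writes
   the input to the tape as it reads it, and then rewinds and simulates the machine by silent steps;
   a letter arriving late leads to rejection. *)
theory Submission
  imports Defs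
begin

text \<open>Transitions are deterministic functions, so the only freedom in the semantics is how
  many silent steps precede each letter and follow the last one. A choice string records these
  numbers. Being finite, it has a terminating run even when the automaton can take silent steps
  forever; trying the strings one after another therefore needs no dovetailing. Machines are total
  step functions whose final configurations are fixed points, so one lemma,
  \<open>simulation_halts\<close>, carries halting from level to level. In the converse direction
  two obstacles shape the automaton. The tape alphabet may have only two symbols, so a machine
  symbol is spread over several cells, with the machine blank coded by blanks. And an automaton
  cannot see the end of its input: its first silent step is a guess that the input is over, and the
  rejecting state punishes a guess made too early.\<close>

section \<open>Iteration of deterministic step functions and transfer of halting\<close>

definition reach :: "('c \<Rightarrow> 'c) \<Rightarrow> 'c \<Rightarrow> 'c \<Rightarrow> bool" where
  "reach f c c' \<longleftrightarrow> (\<exists>n. (f ^^ n) c = c')"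

definition halts :: "('c \<Rightarrow> 'c) \<Rightarrow> ('c \<Rightarrow> bool) \<Rightarrow> 'c \<Rightarrow> bool" where
  "halts f fin c \<longleftrightarrow> (\<exists>n. fin ((f ^^ n) c))"

lemma reach_refl: "reach f c c"
  unfolding reach_def by (rule exI[of _ 0]) simp

lemma reach_step: "reach f (f c) d \<Longrightarrow> reach f c d"
proof -
  assume "reach f (f c) d"
  then obtain n where "(f ^^ n) (f c) = d" by (auto simp: reach_def)
  then have "(f ^^ Suc n) c = d" by (simp add: funpow_swap1)
  then show ?thesis unfolding reach_def by blast
qed

lemma reach_step_eq: "f c = c' \<Longrightarrow> reach f c' d \<Longrightarrow> reach f c d"
  by (rule reach_step) simp

lemma reach_one: "f c = c' \<Longrightarrow> reach f c c'"
  using reach_step_eq reach_refl by metis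

lemma reach_trans: "reach f c d \<Longrightarrow> reach f d e \<Longrightarrow> reach f c e"
proof -
  assume "reach f c d" "reach f d e"
  then obtain m n where "(f ^^ m) c = d" "(f ^^ n) d = e" by (auto simp: reach_def)
  then have "(f ^^ (n + m)) c = e" by (simp add: funpow_add)
  then show ?thesis unfolding reach_def by blast
qed

text \<open>Final configurations are fixed points, so a run that has become final stays final and
  its starting point may be moved along the run.\<close>

lemma halts_reach:
  assumes "\<And>c. fin c \<Longrightarrow> f c = c" and "reach f c d"
  shows "halts f fin c \<longleftrightarrow> halts f fin d"
proof -
  obtain m where m: "(f ^^ m) c = d" using assms(2) by (auto simp: reach_def)
  have absorb: "(f ^^ n) e = e" if "fin e" for n e
    using that assms(1) by (induction n) auto
  show ?thesis
  proof
    assume "halts f fin c"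
    then obtain n where n: "fin ((f ^^ n) c)" by (auto simp: halts_def)
    have "(f ^^ n) ((f ^^ m) c) = (f ^^ m) ((f ^^ n) c)"
      by (simp add: add.commute flip: funpow_add[THEN fun_cong, unfolded comp_apply])
    then have "(f ^^ n) d = (f ^^ m) ((f ^^ n) c)" by (simp add: m)
    then have "fin ((f ^^ n) d)" using n absorb by simp
    then show "halts f fin d" by (auto simp: halts_def)
  next
    assume "halts f fin d"
    then obtain n where n: "fin ((f ^^ n) d)" by (auto simp: halts_def)
    then have "fin ((f ^^ (n + m)) c)" by (simp add: funpow_add m)
    then show "halts f fin c" unfolding halts_def by blast
  qed
qed

lemma halts_final: "fin c \<Longrightarrow> halts f fin c"
  unfolding halts_def by (rule exI[of _ 0]) simp

text \<open>Reaching d' from \<open>f2 d\<close> instead of d forces at least one step of the second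
  machine per step of the first. This progress drives the strong induction for the backward
  direction.\<close>

lemma simulation_halts:
  assumes fin: "\<And>c d. R c d \<Longrightarrow> fin1 c \<longleftrightarrow> fin2 d"
    and sim: "\<And>c d. R c d \<Longrightarrow> \<not> fin1 c \<Longrightarrow> \<exists>d'. reach f2 (f2 d) d' \<and> R (f1 c) d'"
    and absorb: "\<And>d. fin2 d \<Longrightarrow> f2 d = d"
    and "R c d"
  shows "halts f1 fin1 c \<longleftrightarrow> halts f2 fin2 d"
proof
  assume "halts f1 fin1 c"
  then obtain n where "fin1 ((f1 ^^ n) c)" by (auto simp: halts_def)
  then show "halts f2 fin2 d" using \<open>R c d\<close>
  proof (induction n arbitrary: c d)
    case 0
    then show ?case using fin halts_final[of fin2 d f2] by simp
  next
    case (Suc n)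
    show ?case
    proof (cases "fin1 c")
      case True
      then show ?thesis using fin[OF Suc.prems(2)] halts_final[of fin2 d f2] by simp
    next
      case False
      then obtain d' where d': "reach f2 (f2 d) d'" "R (f1 c) d'"
        using sim Suc.prems by blast
      have "halts f2 fin2 d'"
        using Suc.IH[OF _ d'(2)] Suc.prems(1) by (simp add: funpow_swap1)
      then show ?thesis using halts_reach[OF absorb reach_step[OF d'(1)]] by simp
    qed
  qed
next
  have fixn: "(f2 ^^ n) e = e" if "fin2 e" for n e
    using that absorb by (induction n) auto
  assume "halts f2 fin2 d"
  then obtain n where "fin2 ((f2 ^^ n) d)" by (auto simp: halts_def)
  then show "halts f1 fin1 c" using \<open>R c d\<close>
  proof (induction n arbitrary: c d rule: less_induct)
    case (less n)
    show ?case
    proof (cases "fin1 c")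
      case True
      then show ?thesis by (rule halts_final)
    next
      case False
      then obtain d' where d': "reach f2 (f2 d) d'" "R (f1 c) d'"
        using sim less.prems by blast
      then obtain m where m: "(f2 ^^ Suc m) d = d'"
        by (auto simp: reach_def funpow_swap1)
      have "halts f1 fin1 (f1 c)"
      proof (cases "Suc m \<le> n")
        case True
        then have "(f2 ^^ n) d = (f2 ^^ (n - Suc m)) d'"
          unfolding m[symmetric] comp_apply[symmetric, of "f2 ^^ _"] funpow_add[symmetric] by simp
        then show ?thesis using less.IH[of "n - Suc m" d' "f1 c"] less.prems d' True by simp
      next
        \<comment> \<open>The final configuration occurs on the way to d', and it is a fixed point,
          so d' is final itself.\<close>
        case False
        then have "d' = (f2 ^^ (Suc m - n)) ((f2 ^^ n) d)"
          unfolding m[symmetric] comp_apply[symmetric, of "f2 ^^ _"] funpow_add[symmetric] by simp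
        then have "fin2 d'" using fixn[OF less.prems(1), of "Suc m - n"] less.prems(1) by simp
        then show ?thesis using fin[OF d'(2)] by (simp add: halts_final)
      qed
      then obtain j where "fin1 ((f1 ^^ Suc j) c)" by (auto simp: halts_def funpow_swap1)
      then show ?thesis unfolding halts_def by blast
    qed
  qed
qed

section \<open>Turing machines over arbitrary finite state sets and alphabets\<close>

type_synonym ('p, 'c) mach = "'p \<Rightarrow> 'c \<Rightarrow> ('p \<times> 'c \<times> int) option"

definition mstep :: "('p, 'c) mach \<Rightarrow> 'p \<times> int \<times> (int \<Rightarrow> 'c) \<Rightarrow> 'p \<times> int \<times> (int \<Rightarrow> 'c)" where
  "mstep D = (\<lambda>(p, h, tp). case D p (tp h) of None \<Rightarrow> (p, h, tp)
     | Some (p', c, d) \<Rightarrow> (p', h + d, tp(h := c)))"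

definition mfinal :: "('p, 'c) mach \<Rightarrow> 'p \<times> int \<times> (int \<Rightarrow> 'c) \<Rightarrow> bool" where
  "mfinal D = (\<lambda>(p, h, tp). D p (tp h) = None)"

definition minput :: "('a \<Rightarrow> 'c) \<Rightarrow> 'c \<Rightarrow> 'a list \<Rightarrow> int \<Rightarrow> 'c" where
  "minput inp b w = (\<lambda>i. if 0 \<le> i \<and> i < int (length w) then inp (w ! nat i) else b)"

text \<open>Numbering with a distinguished element at 0: it meets the conventions that machines
  start in state 0 with blank \<open>Inr 0\<close>, and later makes the code of the blank all
  blank.\<close>

lemma finite_inj_nat_pointed:
  assumes "finite P"
  obtains f :: "'p \<Rightarrow> nat" where "inj_on f P" "f p = 0"
proof -
  obtain g :: "'p \<Rightarrow> nat" where g: "inj_on g P"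
    using finite_imp_inj_to_nat_seg[OF assms] by blast
  show ?thesis
    by (rule that[of "\<lambda>x. if x = p then 0 else Suc (g x)"])
      (use g in \<open>auto simp: inj_on_def\<close>)
qed

lemma mstep_final: "mfinal D c \<Longrightarrow> mstep D c = c"
  by (auto simp: mfinal_def mstep_def)

lemma tm_halts_mach: "tm_halts \<delta> w \<longleftrightarrow> halts (mstep \<delta>) (mfinal \<delta>) (0, 0, tm_input w)"
proof -
  have "tm_step \<delta> = mstep \<delta>"
    by (auto simp: tm_step_def mstep_def fun_eq_iff split: option.splits)
  then show ?thesis
    unfolding tm_halts_def halts_def mfinal_def by simp
qed

lemma RE_mach:
  fixes D :: "('p, 'c::finite) mach" and inp :: "'a \<Rightarrow> 'c"
  assumes "finite P" "p0 \<in> P"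
    and cl: "\<And>p c p' c' d. p \<in> P \<Longrightarrow> D p c = Some (p', c', d) \<Longrightarrow> p' \<in> P \<and> d \<in> {-1, 0, 1}"
  shows "RE {w. halts (mstep D) (mfinal D) (p0, 0, minput inp b w)}"
proof -
  obtain f :: "'p \<Rightarrow> nat" where f: "inj_on f P" "f p0 = 0"
    using finite_inj_nat_pointed[OF assms(1)] by metis
  obtain g :: "'c \<Rightarrow> nat" where g: "inj g" "g b = 0"
    using finite_inj_nat_pointed[of "UNIV :: 'c set"] by (metis finite)
  \<comment> \<open>Input letters are read through \<open>inp\<close> but only \<open>Inr\<close>
    symbols are ever written, so a cell may have two representations. The simulation relation
    therefore decodes the concrete tape instead of encoding the abstract one.\<close>
  define dec where "dec s = (case s of Inl a \<Rightarrow> inp a | Inr n \<Rightarrow> inv g n)" for s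
  define \<delta> :: "'a tm" where "\<delta> q s = (if q \<in> f ` P then
     map_option (\<lambda>(p', c', d). (f p', Inr (g c'), d)) (D (inv_into P f q) (dec s)) else None)" for q s
  have dec_g: "dec (Inr (g c)) = c" for c
    using g(1) by (simp add: dec_def)
  have dec_0: "dec (Inr 0) = b" using dec_g[of b] g by simp
  have wf: "tm_wf (Suc (Max (f ` P))) (Max (range g)) \<delta>"
    unfolding tm_wf_def
  proof (intro conjI allI impI)
    fix q s q' s' d
    assume "q < Suc (Max (f ` P)) \<and> \<delta> q s = Some (q', s', d)"
    then obtain p p' c' where p: "p \<in> P" "q' = f p'" "s' = Inr (g c')"
      "D p (dec s) = Some (p', c', d)"
      using f by (auto simp: \<delta>_def split: if_splits)
    then have "p' \<in> P" "d \<in> {-1, 0, 1}" using cl by blast+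
    then show "q' < Suc (Max (f ` P))" "d \<in> {-1, 0, 1}" "s' \<in> range Inl \<union> Inr ` {..Max (range g)}"
      using p assms(1) by (auto simp: less_Suc_eq_le)
  qed simp
  have upd: "dec \<circ> t(h := Inr (g c)) = (dec \<circ> t)(h := c)" for t :: "int \<Rightarrow> 'a + nat" and h c
    by (simp add: fun_eq_iff dec_g)
  define R :: "'p \<times> int \<times> (int \<Rightarrow> 'c) \<Rightarrow> nat \<times> int \<times> (int \<Rightarrow> 'a + nat) \<Rightarrow> bool" where
    "R = (\<lambda>(p, h, tp) (q, h', tp'). p \<in> P \<and> q = f p \<and> h = h' \<and> tp = dec \<circ> tp')"
  have \<delta>_f: "\<delta> (f p) s = map_option (\<lambda>(p', c', d). (f p', Inr (g c'), d)) (D p (dec s))"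
    if "p \<in> P" for p s
    using that f by (simp add: \<delta>_def)
  have "halts (mstep D) (mfinal D) (p0, 0, minput inp b w) \<longleftrightarrow> tm_halts \<delta> w" for w
    unfolding tm_halts_mach
  proof (rule simulation_halts[where R = R])
    show "mfinal D c \<longleftrightarrow> mfinal \<delta> d" if "R c d" for c d
      using that by (auto simp: R_def mfinal_def \<delta>_f)
    show "\<exists>d'. reach (mstep \<delta>) (mstep \<delta> d) d' \<and> R (mstep D c) d'"
      if "R c d" "\<not> mfinal D c" for c d
    proof (intro exI conjI)
      show "reach (mstep \<delta>) (mstep \<delta> d) (mstep \<delta> d)" by (rule reach_refl)
      show "R (mstep D c) (mstep \<delta> d)"
        using that cl by (auto simp: R_def mfinal_def mstep_def \<delta>_f upd)
    qed
    show "R (p0, 0, minput inp b w) (0, 0, tm_input w)"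
      using assms(2) f(2) dec_0 by (auto simp: R_def minput_def tm_input_def fun_eq_iff dec_def)
  qed (rule mstep_final)
  then show ?thesis unfolding RE_def using wf by (intro exI) auto
qed

section \<open>Multi-stack machines\<close>

text \<open>A control state either halts or pops one stack (seeing \<open>None\<close> if it is empty) and then pushes
  at most one symbol.\<close>
type_synonym ('q, 'k, 'c) prog = "'q \<Rightarrow> ('k \<times> ('c option \<Rightarrow> 'q \<times> ('k \<times> 'c) option)) option"

definition peek :: "'c list \<Rightarrow> 'c option" where
  "peek xs = (case xs of [] \<Rightarrow> None | x # _ \<Rightarrow> Some x)"

lemma peek_simps [simp]: "peek [] = None" "peek (x # xs) = Some x"
  by (simp_all add: peek_def)

fun push :: "('k \<times> 'c) option \<Rightarrow> ('k \<Rightarrow> 'c list) \<Rightarrow> 'k \<Rightarrow> 'c list" where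
  "push None st = st"
| "push (Some (k, c)) st = st(k := c # st k)"

definition sstep :: "('q, 'k, 'c) prog \<Rightarrow> 'q \<times> ('k \<Rightarrow> 'c list) \<Rightarrow> 'q \<times> ('k \<Rightarrow> 'c list)" where
  "sstep pr = (\<lambda>(q, st). case pr q of None \<Rightarrow> (q, st)
     | Some (k, f) \<Rightarrow> (fst (f (peek (st k))), push (snd (f (peek (st k)))) (st(k := tl (st k)))))"

definition sfinal :: "('q, 'k, 'c) prog \<Rightarrow> 'q \<times> ('k \<Rightarrow> 'c list) \<Rightarrow> bool" where
  "sfinal pr = (\<lambda>(q, st). pr q = None)"

text \<open>Each stack is a track growing to the right from position 0; the cell at position -1 carries a
  marker. A stack operation starts and ends on the marker.\<close>
datatype ('q, 'k, 'c) phase = Init | Mark | At 'q | Seek 'q | Grab 'q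
  | Back 'q "('k \<times> 'c) option" | Put 'k 'c 'q

type_synonym ('k, 'c) cell = "bool \<times> ('k \<Rightarrow> 'c option)"

text \<open>\<open>Seek\<close> runs past the end of the track and \<open>Grab\<close> steps back
  onto the top of the stack; if the stack is empty, that cell is the marker, which holds no entry
  and so reads as \<open>None\<close>. After a push, \<open>Put\<close> continues with
  \<open>Back q None\<close> so that the symbol is not pushed twice.\<close>

fun stack_mach :: "('q, 'k, 'c) prog \<Rightarrow> 'q \<Rightarrow> (('q, 'k, 'c) phase, ('k, 'c) cell) mach" where
  "stack_mach pr q0 Init v = Some (Mark, v, -1)"
| "stack_mach pr q0 Mark v = Some (At q0, (True, \<lambda>_. None), 0)"
| "stack_mach pr q0 (At q) v = (if pr q = None then None else Some (Seek q, v, 1))"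
| "stack_mach pr q0 (Seek q) (m, v) = (case the (pr q) of (k, f) \<Rightarrow>
     if v k = None then Some (Grab q, (m, v), -1) else Some (Seek q, (m, v), 1))"
| "stack_mach pr q0 (Grab q) (m, v) = (case the (pr q) of (k, f) \<Rightarrow>
     Some (Back (fst (f (v k))) (snd (f (v k))), (m, v(k := None)), 0))"
| "stack_mach pr q0 (Back q ps) (m, v) = (if m then
     (case ps of None \<Rightarrow> Some (At q, (m, v), 0) | Some (k, c) \<Rightarrow> Some (Put k c q, (m, v), 1))
     else Some (Back q ps, (m, v), -1))"
| "stack_mach pr q0 (Put k c q) (m, v) = (if v k = None then Some (Back q None, (m, v(k := Some c)), 0)
     else Some (Put k c q, (m, v), 1))"

text \<open>\<open>Seek\<close> and \<open>Grab\<close> evaluate \<open>the (pr q)\<close>;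
  requiring \<open>pr q \<noteq> None\<close> keeps the successor within the finite set of
  states.\<close>

fun phase_ok :: "('q, 'k, 'c) prog \<Rightarrow> 'q set \<Rightarrow> ('q, 'k, 'c) phase \<Rightarrow> bool" where
  "phase_ok pr Q (At q) = (q \<in> Q)"
| "phase_ok pr Q (Seek q) = (q \<in> Q \<and> pr q \<noteq> None)"
| "phase_ok pr Q (Grab q) = (q \<in> Q \<and> pr q \<noteq> None)"
| "phase_ok pr Q (Back q ps) = (q \<in> Q)"
| "phase_ok pr Q (Put k c q) = (q \<in> Q)"
| "phase_ok pr Q p = True"

text \<open>Lists have the top of the stack at the head, hence \<open>rev\<close>: the bottom lies
  in cell 0, and a push or pop changes only the right end of a track.\<close>

definition tracks :: "('k \<Rightarrow> 'c list) \<Rightarrow> int \<Rightarrow> ('k, 'c) cell" where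
  "tracks st = (\<lambda>j. (j = -1, \<lambda>k. if 0 \<le> j \<and> j < int (length (st k)) then Some (rev (st k) ! nat j) else None))"

lemma tracks_marker [simp]:
  "tracks st (-1) = (True, \<lambda>_. None)" "(tracks st)(-1 := (True, \<lambda>_. None)) = tracks st"
  by (auto simp: tracks_def)

lemma scan_right:
  assumes "\<And>j. h \<le> j \<Longrightarrow> j < h + int n \<Longrightarrow> D p (tp j) = Some (p, tp j, 1)"
  shows "reach (mstep D) (p, h, tp) (p, h + int n, tp)"
  using assms
proof (induction n arbitrary: h)
  case 0
  then show ?case by (simp add: reach_refl)
next
  case (Suc n)
  have "mstep D (p, h, tp) = (p, h + 1, tp)"
    using Suc.prems[of h] by (simp add: mstep_def)
  moreover have "reach (mstep D) (p, h + 1, tp) (p, (h + 1) + int n, tp)"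
    by (rule Suc.IH) (use Suc.prems in auto)
  ultimately show ?case by - (rule reach_step, simp add: algebra_simps)
qed

lemma scan_left:
  assumes "\<And>j. h - int n < j \<Longrightarrow> j \<le> h \<Longrightarrow> D p (tp j) = Some (p, tp j, -1)"
  shows "reach (mstep D) (p, h, tp) (p, h - int n, tp)"
  using assms
proof (induction n arbitrary: h)
  case 0
  then show ?case by (simp add: reach_refl)
next
  case (Suc n)
  have "mstep D (p, h, tp) = (p, h - 1, tp)"
    using Suc.prems[of h] by (simp add: mstep_def)
  moreover have "reach (mstep D) (p, h - 1, tp) (p, (h - 1) - int n, tp)"
    by (rule Suc.IH) (use Suc.prems in auto)
  ultimately show ?case by - (rule reach_step, simp add: algebra_simps)
qed

text \<open>For an empty stack the cell in question is the marker at -1, empty in every track, so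
  popping leaves it unchanged, in accordance with \<open>tl [] = []\<close>.\<close>

lemma tracks_pop:
  "(tracks st)(int (length (st k)) - 1 :=
      (fst (tracks st (int (length (st k)) - 1)), (snd (tracks st (int (length (st k)) - 1)))(k := None)))
   = tracks (st(k := tl (st k)))"
proof (cases "st k")
  case Nil
  then show ?thesis by (auto simp: tracks_def fun_eq_iff)
next
  case (Cons c cs)
  then show ?thesis
    by (auto simp: tracks_def fun_eq_iff nth_append)
qed

lemma tracks_peek: "snd (tracks st (int (length (st k)) - 1)) k = peek (st k)"
  by (cases "st k") (auto simp: tracks_def nth_append)

lemma tracks_end: "snd (tracks st j) k = None \<longleftrightarrow> j < 0 \<or> int (length (st k)) \<le> j"
  by (auto simp: tracks_def)

lemma tracks_push:
  "(tracks st)(int (length (st k)) :=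
      (fst (tracks st (int (length (st k)))), (snd (tracks st (int (length (st k)))))(k := Some c)))
   = tracks (st(k := c # st k))"
  by (auto simp: tracks_def fun_eq_iff nth_append)

lemma back_reach:
  assumes "-1 \<le> h"
  shows "reach (mstep (stack_mach pr q0)) (Back q ps, h, tracks st) (Back q ps, -1, tracks st)"
proof -
  have "reach (mstep (stack_mach pr q0)) (Back q ps, h, tracks st) (Back q ps, h - int (nat (h + 1)), tracks st)"
    by (rule scan_left) (use assms in \<open>auto simp: tracks_def\<close>)
  then show ?thesis using assms by simp
qed

lemma push_reach:
  "reach (mstep (stack_mach pr q0)) (Back q ps, -1, tracks st) (At q, -1, tracks (push ps st))"
proof (cases ps)
  case None
  have "mstep (stack_mach pr q0) (Back q ps, -1, tracks st) = (At q, -1, tracks st)"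
    by (simp add: mstep_def None)
  then show ?thesis using None by - (rule reach_step, simp add: reach_refl)
next
  case (Some kc)
  then obtain k c where ps: "ps = Some (k, c)" by (cases kc) auto
  let ?M = "mstep (stack_mach pr q0)"
  let ?n = "int (length (st k))" and ?st = "st(k := c # st k)"
  have 1: "?M (Back q ps, -1, tracks st) = (Put k c q, 0, tracks st)"
    by (simp add: mstep_def ps)
  have 2: "reach ?M (Put k c q, 0, tracks st) (Put k c q, 0 + ?n, tracks st)"
    by (rule scan_right) (auto simp: tracks_def)
  have "snd (tracks st ?n) k = None" by (simp add: tracks_end)
  then have 3: "?M (Put k c q, ?n, tracks st) = (Back q None, ?n, tracks ?st)"
    by (simp add: mstep_def flip: tracks_push) (cases "tracks st ?n", simp)
  have 4: "reach ?M (Back q None, ?n, tracks ?st) (Back q None, -1, tracks ?st)"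
    by (rule back_reach) simp
  have 5: "?M (Back q None, -1, tracks ?st) = (At q, -1, tracks ?st)"
    by (simp add: mstep_def)
  have "reach ?M (Put k c q, ?n, tracks st) (At q, -1, tracks ?st)"
    by (rule reach_step, unfold 3, rule reach_trans[OF 4], rule reach_step, unfold 5, rule reach_refl)
  then have "reach ?M (Put k c q, 0, tracks st) (At q, -1, tracks ?st)"
    using reach_trans[OF 2] by simp
  then show ?thesis
    unfolding ps push.simps by - (rule reach_step, use 1 ps in simp)
qed

lemma stack_step_reach:
  assumes "pr q = Some (k, f)"
  shows "reach (mstep (stack_mach pr q0)) (mstep (stack_mach pr q0) (At q, -1, tracks st))
    (At (fst (sstep pr (q, st))), -1, tracks (snd (sstep pr (q, st))))"
proof -
  let ?M = "mstep (stack_mach pr q0)"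
  let ?n = "int (length (st k))" and ?st = "st(k := tl (st k))"
  let ?q = "fst (f (peek (st k)))" and ?ps = "snd (f (peek (st k)))"
  have 1: "?M (At q, -1, tracks st) = (Seek q, 0, tracks st)"
    by (simp add: mstep_def assms)
  have 2: "reach ?M (Seek q, 0, tracks st) (Seek q, 0 + ?n, tracks st)"
    by (rule scan_right) (auto simp: tracks_def assms)
  have "snd (tracks st ?n) k = None" by (simp add: tracks_end)
  then have 3: "?M (Seek q, ?n, tracks st) = (Grab q, ?n - 1, tracks st)"
    by (cases "tracks st ?n") (simp add: mstep_def assms fun_upd_idem)
  have 4: "?M (Grab q, ?n - 1, tracks st) = (Back ?q ?ps, ?n - 1, tracks ?st)"
    using tracks_peek[of st k] tracks_pop[of st k]
    by (cases "tracks st (?n - 1)") (simp add: mstep_def assms)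
  have 5: "reach ?M (Back ?q ?ps, ?n - 1, tracks ?st) (At ?q, -1, tracks (push ?ps ?st))"
    by (rule reach_trans[OF back_reach push_reach]) simp
  have "reach ?M (Seek q, ?n, tracks st) (At ?q, -1, tracks (push ?ps ?st))"
    by (rule reach_step, unfold 3, rule reach_step, unfold 4, rule 5)
  then show ?thesis
    unfolding 1 using 2 by (auto simp: sstep_def assms intro: reach_trans)
qed

text \<open>A word on the input tape already is a track with its last letter on top, which is why
  stack k0 starts with the reversed word. Only the marker is missing; \<open>Init\<close> and
  \<open>Mark\<close> place it.\<close>

lemma RE_stack:
  fixes pr :: "('q, 'k::finite, 'c::finite) prog" and inp :: "'a \<Rightarrow> 'c"
  assumes "finite Q" "q0 \<in> Q"
    and cl: "\<And>q k f t. q \<in> Q \<Longrightarrow> pr q = Some (k, f) \<Longrightarrow> fst (f t) \<in> Q"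
  shows "RE {w. halts (sstep pr) (sfinal pr) (q0, \<lambda>k. if k = k0 then rev (map inp w) else [])}"
proof -
  let ?D = "stack_mach pr q0"
  let ?P = "{p :: ('q, 'k, 'c) phase. phase_ok pr Q p}"
  define icell :: "'a \<Rightarrow> ('k, 'c) cell" where "icell a = (False, (\<lambda>_. None)(k0 := Some (inp a)))" for a
  define bcell :: "('k, 'c) cell" where "bcell = (False, \<lambda>_. None)"
  have "RE {w. halts (mstep ?D) (mfinal ?D) (Init, 0, minput icell bcell w)}"
  proof (rule RE_mach)
    show "finite ?P"
    proof (rule finite_subset)
      show "?P \<subseteq> {Init, Mark} \<union> At ` Q \<union> Seek ` Q \<union> Grab ` Q
          \<union> (\<lambda>(q, ps). Back q ps) ` (Q \<times> UNIV) \<union> (\<lambda>(k, c, q). Put k c q) ` (UNIV \<times> UNIV \<times> Q)" (is "_ \<subseteq> ?F")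
      proof
        fix p
        assume "p \<in> ?P"
        then show "p \<in> ?F" by (cases p) (auto simp: image_iff)
      qed
      show "finite ?F" using assms(1) by (intro finite_UnI finite_imageI finite_cartesian_product) auto
    qed
    fix p c p' c' d
    assume "p \<in> ?P" "?D p c = Some (p', c', d)"
    then show "p' \<in> ?P \<and> d \<in> {-1, 0, 1}"
      using assms(2) by (cases c; cases p) (auto split: if_splits option.splits prod.splits dest: cl)
  qed simp
  moreover have "halts (sstep pr) (sfinal pr) (q0, \<lambda>k. if k = k0 then rev (map inp w) else [])
    \<longleftrightarrow> halts (mstep ?D) (mfinal ?D) (Init, 0, minput icell bcell w)" for w
  proof -
    let ?st = "\<lambda>k. if k = k0 then rev (map inp w) else []"
    define R :: "'q \<times> ('k \<Rightarrow> 'c list) \<Rightarrow> _" where "R = (\<lambda>(q, st) d. d = (At q :: ('q, 'k, 'c) phase, - 1 :: int, tracks st))"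
    have "halts (sstep pr) (sfinal pr) (q0, ?st) \<longleftrightarrow> halts (mstep ?D) (mfinal ?D) (At q0, -1, tracks ?st)"
    proof (rule simulation_halts[where R = R])
      show "sfinal pr c = mfinal ?D d" if "R c d" for c d
        using that by (auto simp: R_def sfinal_def mfinal_def split: if_splits)
      show "\<exists>d'. reach (mstep ?D) (mstep ?D d) d' \<and> R (sstep pr c) d'"
        if "R c d" "\<not> sfinal pr c" for c d
      proof -
        obtain q st k f where c: "c = (q, st)" "d = (At q, -1, tracks st)" "pr q = Some (k, f)"
          using \<open>R c d\<close> \<open>\<not> sfinal pr c\<close> by (cases c) (auto simp: R_def sfinal_def)
        have "R (sstep pr c) (At (fst (sstep pr c)), -1, tracks (snd (sstep pr c)))"
          by (cases "sstep pr c") (simp add: R_def)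
        then show ?thesis using stack_step_reach[of pr q k f] c by blast
      qed
    qed (auto simp: R_def mstep_final)
    moreover have "mstep ?D (mstep ?D (Init, 0, minput icell bcell w)) = (At q0, -1, tracks ?st)"
      by (auto simp: mstep_def minput_def tracks_def icell_def bcell_def fun_eq_iff)
    then have "reach (mstep ?D) (Init, 0, minput icell bcell w) (At q0, -1, tracks ?st)"
      by - (rule reach_step, rule reach_step, simp add: reach_refl)
    note halts_reach[where fin = "mfinal ?D" and f = "mstep ?D", OF mstep_final this]
    ultimately show ?thesis by blast
  qed
  ultimately show ?thesis by simp
qed

section \<open>Runs of a tape automaton\<close>

definition tstep :: "('x \<Rightarrow> 'a option \<Rightarrow> ('x, 'g) tcomp) \<Rightarrow> 'a option
    \<Rightarrow> 'x \<times> int \<times> 'g tape \<Rightarrow> 'x \<times> int \<times> 'g tape" where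
  "tstep tr a = (\<lambda>(x, i, s). tr x a i s)"

text \<open>A choice string resolves the nondeterminism: \<open>False\<close> performs a silent step, \<open>True\<close> consumes the
  next letter. Letting \<open>True\<close> do nothing on exhausted input keeps runs total without adding
  behaviour.\<close>
fun exec :: "('x \<Rightarrow> 'a option \<Rightarrow> ('x, 'g) tcomp) \<Rightarrow> bool list \<Rightarrow> ('x \<times> int \<times> 'g tape) \<times> 'a list
    \<Rightarrow> ('x \<times> int \<times> 'g tape) \<times> 'a list" where
  "exec tr [] (c, v) = (c, v)"
| "exec tr (False # bs) (c, v) = exec tr bs (tstep tr None c, v)"
| "exec tr (True # bs) (c, []) = exec tr bs (c, [])"
| "exec tr (True # bs) (c, a # v) = exec tr bs (tstep tr (Some a) c, v)"

definition accepting :: "('x \<Rightarrow> 'g obs) \<Rightarrow> ('x \<times> int \<times> 'g tape) \<times> 'a list \<Rightarrow> bool" where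
  "accepting out = (\<lambda>((x, i, s), v). v = [] \<and> out x i s)"

lemma exec_append: "exec tr (bs @ bs') cv = exec tr bs' (exec tr bs cv)"
  by (induction tr bs cv rule: exec.induct) auto

lemma exec_replicate_False: "exec tr (replicate n False) (c, v) = ((tstep tr None ^^ n) c, v)"
  by (induction n arbitrary: c) (auto simp: funpow_swap1)

lemma exec_Nil: "\<exists>n. exec tr bs (c, []) = ((tstep tr None ^^ n) c, [])"
proof (induction bs arbitrary: c)
  case Nil
  show ?case by (rule exI[of _ 0]) simp
next
  case (Cons b bs)
  show ?case
  proof (cases b)
    case True
    then show ?thesis using Cons by simp
  next
    case False
    obtain n where "exec tr bs (tstep tr None c, []) = ((tstep tr None ^^ n) (tstep tr None c), [])"
      using Cons by blast
    then show ?thesis using False by (intro exI[of _ "Suc n"]) (simp add: funpow_swap1)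
  qed
qed

text \<open>A choice string that exhausts a nonempty input contains \<open>True\<close>; the
  \<open>False\<close> entries before the first \<open>True\<close> are the n silent steps.\<close>

lemma exec_Cons_empties:
  assumes "snd (exec tr bs (c, a # u)) = []"
  shows "\<exists>n bs'. exec tr bs (c, a # u) = exec tr bs' (tstep tr (Some a) ((tstep tr None ^^ n) c), u)"
  using assms
proof (induction bs arbitrary: c)
  case Nil
  then show ?case by simp
next
  case (Cons b bs)
  show ?case
  proof (cases b)
    case True
    then show ?thesis by (intro exI[of _ 0] exI[of _ bs]) simp
  next
    case False
    then obtain n bs' where "exec tr bs (tstep tr None c, a # u)
        = exec tr bs' (tstep tr (Some a) ((tstep tr None ^^ n) (tstep tr None c)), u)"
      using Cons.IH[of "tstep tr None c"] Cons.prems by auto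
    then show ?thesis using False by (intro exI[of _ "Suc n"] exI[of _ bs']) (simp add: funpow_swap1)
  qed
qed

text \<open>\<open>kappa\<close> of a computation evaluates the continuation at the configuration
  reached, so binding computations amounts to iterating \<open>tstep\<close>.\<close>

lemma tauchain_iff: "tauchain tr n x f i s = (case (tstep tr None ^^ n) (x, i, s) of (y, j, t) \<Rightarrow> f y j t)"
proof (induction n arbitrary: x i s)
  case 0
  then show ?case by (simp add: ceta_def)
next
  case (Suc n)
  then show ?case
    by (cases "tr x None i s")
      (simp add: cbind_def tstar_def kappa_def funpow_Suc_right del: funpow.simps, simp add: tstep_def)
qed

text \<open>The countable disjunctions are existential quantifiers over the numbers of silent steps,
  one per letter and one at the end; a choice string packs them all into one witness.\<close>

lemma obs_sem_iff:
  fixes tr :: "'x \<Rightarrow> 'a option \<Rightarrow> ('x, 'g) tcomp"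
  shows "obs_sem out tr w x i s \<longleftrightarrow> (\<exists>bs. accepting out (exec tr bs ((x, i, s), w)))"
proof (induction w arbitrary: x i s)
  case Nil
  have "obs_sem out tr [] x i s \<longleftrightarrow> (\<exists>n. accepting out ((tstep tr None ^^ n) (x, i, s), [] :: 'a list))"
    (is "_ \<longleftrightarrow> (\<exists>n. ?A n)")
  proof -
    have "obs_sem out tr [] x i s \<longleftrightarrow> ?A 0 \<or> (\<exists>n\<ge>1. ?A n)"
      by (simp add: ov_def tauchain_iff accepting_def case_prod_beta)
    moreover have "?A 0 \<or> (\<exists>n\<ge>1. ?A n)" if "?A n" for n
      using that by (cases n) auto
    ultimately show ?thesis by blast
  qed
  also have "\<dots> \<longleftrightarrow> (\<exists>bs. accepting out (exec tr bs ((x, i, s), [])))"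
    using exec_Nil[of tr _ "(x, i, s)"] exec_replicate_False[of tr _ "(x, i, s)" "[]"] by metis
  finally show ?case .
next
  case (Cons a u)
  have "obs_sem out tr (a # u) x i s \<longleftrightarrow>
      (\<exists>n bs. accepting out (exec tr bs (tstep tr (Some a) ((tstep tr None ^^ n) (x, i, s)), u)))"
    by (simp add: av_def cbind_def tv_def ceta_def tauchain_iff tstar_def kappa_def case_prod_beta Cons)
      (simp add: tstep_def case_prod_beta)
  also have "\<dots> \<longleftrightarrow> (\<exists>bs. accepting out (exec tr bs ((x, i, s), a # u)))"
  proof
    assume "\<exists>n bs. accepting out (exec tr bs (tstep tr (Some a) ((tstep tr None ^^ n) (x, i, s)), u))"
    then obtain n bs where "accepting out (exec tr bs (tstep tr (Some a) ((tstep tr None ^^ n) (x, i, s)), u))"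
      by blast
    then have "accepting out (exec tr (replicate n False @ True # bs) ((x, i, s), a # u))"
      by (simp add: exec_append exec_replicate_False)
    then show "\<exists>bs. accepting out (exec tr bs ((x, i, s), a # u))" by blast
  next
    assume "\<exists>bs. accepting out (exec tr bs ((x, i, s), a # u))"
    then obtain bs where bs: "accepting out (exec tr bs ((x, i, s), a # u))" by blast
    then have "snd (exec tr bs ((x, i, s), a # u)) = []" by (auto simp: accepting_def)
    from exec_Cons_empties[OF this] bs
    show "\<exists>n bs. accepting out (exec tr bs (tstep tr (Some a) ((tstep tr None ^^ n) (x, i, s)), u))"
      by metis
  qed
  finally show ?case .
qed

section \<open>Locality radii\<close>

lemma shift_shift: "shift (shift s i) j = shift s (j + i)"
  by (auto simp: shift_def add.assoc)

text \<open>A larger radius asks for more agreement of the resulting tapes, but between the two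
  radii p changes nothing and the given tapes agree there already.\<close>

lemma tloc_mono:
  fixes p :: "('x, 'g) tcomp"
  assumes "tloc k p" "k \<le> k'"
  shows "tloc k' p"
proof -
  have near: "eq_near i k s s'" if "eq_near i k' s s'" for i and s s' :: "'g tape"
    using that assms(2) by (auto simp: eq_near_def)
  have loc: "eq_near i k (snd (snd (p i s))) (snd (snd (p i s')))
      \<and> fst (p i s) = fst (p i s')
      \<and> \<bar>fst (snd (p i s)) - i\<bar> \<le> int k
      \<and> eq_far i k (snd (snd (p i s))) s
      \<and> fst (snd (p i s)) = fst (snd (p i s'))
      \<and> snd (snd (p i (shift s j))) = shift (snd (snd (p (i + j) s))) j
      \<and> fst (p i (shift s j)) = fst (p (i + j) s)
      \<and> fst (snd (p i (shift s j))) = fst (snd (p (i + j) s)) - j"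
    if "eq_near i k s s'" for i j s s'
    using assms(1) that unfolding tloc_def by blast
  show ?thesis
    unfolding tloc_def
  proof (intro allI impI)
    fix i j :: int and s s' :: "'g tape"
    assume n': "eq_near i k' s s'"
    note l = loc[OF near[OF n'], of j]
    \<comment> \<open>The far clause speaks only of the first tape of a pair, so the pair of s' with
      itself yields it for s'.\<close>
    have f: "eq_far i k (snd (snd (p i s'))) s'"
      using loc[of i s' s'] by (simp add: eq_near_def)
    have "eq_near i k' (snd (snd (p i s))) (snd (snd (p i s')))"
      unfolding eq_near_def
    proof (intro allI impI)
      fix l
      assume "\<bar>i - l\<bar> \<le> int k'"
      then show "snd (snd (p i s)) l = snd (snd (p i s')) l"
        using l f n' by (cases "\<bar>i - l\<bar> \<le> int k") (auto simp: eq_near_def eq_far_def)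
    qed
    then show "eq_near i k' (snd (snd (p i s))) (snd (snd (p i s')))
      \<and> fst (p i s) = fst (p i s')
      \<and> \<bar>fst (snd (p i s)) - i\<bar> \<le> int k'
      \<and> eq_far i k' (snd (snd (p i s))) s
      \<and> fst (snd (p i s)) = fst (snd (p i s'))
      \<and> snd (snd (p i (shift s j))) = shift (snd (snd (p (i + j) s))) j
      \<and> fst (p i (shift s j)) = fst (p (i + j) s)
      \<and> fst (snd (p i (shift s j))) = fst (snd (p (i + j) s)) - j"
      using l assms(2) by (auto simp: eq_far_def)
  qed
qed

definition obsloc :: "nat \<Rightarrow> 'g obs \<Rightarrow> bool" where
  "obsloc k p \<longleftrightarrow> (\<forall>i s s'. eq_near i k s s' \<longrightarrow> p i s = p i s') \<and> (\<forall>i j s. p i (shift s j) = p (i + j) s)"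

lemma eq_near_mono: "eq_near i k' s s' \<Longrightarrow> k \<le> k' \<Longrightarrow> eq_near i k s s'"
  by (auto simp: eq_near_def)

lemma obsloc_mono: "obsloc k p \<Longrightarrow> k \<le> k' \<Longrightarrow> obsloc k' p"
  unfolding obsloc_def using eq_near_mono by blast

lemma Bset_obsloc: "p \<in> Bset \<longleftrightarrow> (\<exists>k. obsloc k p)"
  by (auto simp: Bset_def obsloc_def)

text \<open>One window size has to serve all states and letters; it exists because both are finite
  in number. The sum bounds both maxima, and \<open>insert 0\<close> keeps \<open>Max\<close>
  meaningful for empty X.\<close>

lemma uniform_radius:
  fixes tr :: "'x \<Rightarrow> ('a::finite) option \<Rightarrow> ('x, 'g) tcomp"
  assumes "tape_automaton X out tr"
  obtains k where "\<And>x. x \<in> X \<Longrightarrow> obsloc k (out x)" "\<And>x a. x \<in> X \<Longrightarrow> tloc k (tr x a)"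
proof -
  have fin: "finite X" using assms by (simp add: tape_automaton_def)
  have "\<forall>x\<in>X. \<exists>k. obsloc k (out x)" using assms by (auto simp: tape_automaton_def Bset_obsloc)
  then obtain ko where ko: "\<And>x. x \<in> X \<Longrightarrow> obsloc (ko x) (out x)" by metis
  have "\<forall>xa\<in>X \<times> UNIV. \<exists>k. tloc k (tr (fst xa) (snd xa))"
    using assms by (auto simp: tape_automaton_def TX_def)
  then obtain kt where kt: "\<And>x a. x \<in> X \<Longrightarrow> tloc (kt (x, a)) (tr x a)"
    by (metis fst_conv mem_Sigma_iff snd_conv UNIV_I)
  show ?thesis
  proof
    let ?k = "Max (insert 0 (ko ` X)) + Max (insert 0 (kt ` (X \<times> UNIV)))"
    fix x
    assume x: "x \<in> X"
    have "ko x \<le> Max (insert 0 (ko ` X))" using x fin by simp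
    then show "obsloc ?k (out x)" using obsloc_mono[OF ko[OF x]] by simp
    fix a
    have "kt (x, a) \<le> Max (insert 0 (kt ` (X \<times> UNIV)))" using x fin by (intro Max_ge) auto
    then show "tloc ?k (tr x a)" using tloc_mono[OF kt[OF x]] by simp
  qed
qed

section \<open>Tape automata accept recursively enumerable languages\<close>

text \<open>Bijective base-2 numerals, least significant digit first, so that iterating the successor from
  the empty string visits every string.\<close>
fun succ_str :: "bool list \<Rightarrow> bool list" where
  "succ_str [] = [False]"
| "succ_str (True # bs) = False # succ_str bs"
| "succ_str (False # bs) = True # bs"

fun str_val :: "bool list \<Rightarrow> nat" where
  "str_val [] = 0"
| "str_val (b # bs) = (if b then 2 else 1) + 2 * str_val bs"

lemma str_val_succ: "str_val (succ_str bs) = Suc (str_val bs)"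
  by (induction bs rule: succ_str.induct) auto

text \<open>The digits are 1 and 2, so the parity of the value determines the lowest digit.\<close>

lemma str_val_inj: "str_val bs = str_val bs' \<Longrightarrow> bs = bs'"
proof (induction bs arbitrary: bs')
  case Nil
  then show ?case by (cases bs') (auto split: if_splits)
next
  case (Cons b bs)
  then obtain c cs where bs': "bs' = c # cs" by (cases bs') (auto split: if_splits)
  have "b = c" "str_val bs = str_val cs"
    using Cons.prems unfolding bs' by (auto split: if_splits) presburger+
  then show ?case using Cons.IH bs' by simp
qed

text \<open>The n-th iterate has value n, so by injectivity a string is the iterate numbered by its
  value. The form \<open>Suc n\<close> fits a search that increments before it tests and thus skips
  the empty string.\<close>

lemma succ_str_surj: "bs \<noteq> [] \<Longrightarrow> \<exists>n. bs = (succ_str ^^ Suc n) []"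
proof -
  have v: "str_val ((succ_str ^^ n) []) = n" for n
    by (induction n) (simp_all add: str_val_succ)
  assume "bs \<noteq> []"
  then have "0 < str_val bs" by (cases bs) (auto split: if_splits)
  then obtain n where "str_val bs = Suc n" by (metis gr0_implies_Suc)
  then have "bs = (succ_str ^^ Suc n) []" using v str_val_inj by metis
  then show ?thesis by blast
qed

text \<open>\<open>Used\<close> and \<open>Done\<close> collect what a run takes from
  \<open>Choices\<close> and \<open>Input\<close>, so that a failed attempt can be undone.\<close>

datatype stk = Choices | Used | Input | Done | Lft | Rgt

instance stk :: finite
proof
  have "(UNIV :: stk set) = {Choices, Used, Input, Done, Lft, Rgt}"
    using stk.exhaust by auto
  then show "finite (UNIV :: stk set)" by (metis finite.emptyI finite.insertI)
qed

text \<open>The second component of a state is the tape contents near the head, relative to the head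
  position and blanked out beyond the radius of the automaton.\<close>
datatype ('x, 'g) ctl = ClrLft | ClrRgt | Restore | Incr | Rewind
  | Run 'x "'g tape" | Feed 'x "'g tape" | Shift 'x "'g tape" int | Check 'x "'g tape" | Acc

type_synonym ('a, 'g) sym = "'a + 'g + bool"

abbreviation letter :: "'a \<Rightarrow> ('a, 'g) sym" where "letter a \<equiv> Inl a"
abbreviation tcell :: "'g \<Rightarrow> ('a, 'g) sym" where "tcell g \<equiv> Inr (Inl g)"
abbreviation bit :: "bool \<Rightarrow> ('a, 'g) sym" where "bit b \<equiv> Inr (Inr b)"

fun stacks :: "bool list \<Rightarrow> bool list \<Rightarrow> 'a list \<Rightarrow> 'a list \<Rightarrow> 'g list \<Rightarrow> 'g list \<Rightarrow> stk \<Rightarrow> ('a, 'g) sym list" where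
  "stacks ch us v dn l r Choices = map bit ch"
| "stacks ch us v dn l r Used = map bit us"
| "stacks ch us v dn l r Input = map letter v"
| "stacks ch us v dn l r Done = map letter dn"
| "stacks ch us v dn l r Lft = map tcell l"
| "stacks ch us v dn l r Rgt = map tcell r"

lemma stacks_upd [simp]:
  "(stacks ch us v dn l r)(Choices := map bit ch') = stacks ch' us v dn l r"
  "(stacks ch us v dn l r)(Used := map bit us') = stacks ch us' v dn l r"
  "(stacks ch us v dn l r)(Input := map letter v') = stacks ch us v' dn l r"
  "(stacks ch us v dn l r)(Done := map letter dn') = stacks ch us v dn' l r"
  "(stacks ch us v dn l r)(Lft := map tcell l') = stacks ch us v dn l' r"
  "(stacks ch us v dn l r)(Rgt := map tcell r') = stacks ch us v dn l r'"
  by (rule ext, rename_tac k, case_tac k; simp)+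

lemma stacks_upd_Nil [simp]:
  "(stacks ch us v dn l r)(Choices := []) = stacks [] us v dn l r"
  "(stacks ch us v dn l r)(Used := []) = stacks ch [] v dn l r"
  "(stacks ch us v dn l r)(Input := []) = stacks ch us [] dn l r"
  "(stacks ch us v dn l r)(Done := []) = stacks ch us v [] l r"
  "(stacks ch us v dn l r)(Lft := []) = stacks ch us v dn [] r"
  "(stacks ch us v dn l r)(Rgt := []) = stacks ch us v dn l []"
  by (rule ext, rename_tac k, case_tac k; simp)+

lemma stacks_upd_Cons [simp]:
  "(stacks ch us v dn l r)(Choices := bit b # map bit ch') = stacks (b # ch') us v dn l r"
  "(stacks ch us v dn l r)(Used := bit b # map bit us') = stacks ch (b # us') v dn l r"
  "(stacks ch us v dn l r)(Input := letter a # map letter v') = stacks ch us (a # v') dn l r"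
  "(stacks ch us v dn l r)(Done := letter a # map letter dn') = stacks ch us v (a # dn') l r"
  "(stacks ch us v dn l r)(Lft := tcell g # map tcell l') = stacks ch us v dn (g # l') r"
  "(stacks ch us v dn l r)(Rgt := tcell g # map tcell r') = stacks ch us v dn l (g # r')"
  by (rule ext, rename_tac k, case_tac k; simp)+

locale search =
  fixes X :: "'x set" and out :: "'x \<Rightarrow> 'g::finite obs" and tr :: "'x \<Rightarrow> ('a::finite) option \<Rightarrow> ('x, 'g) tcomp"
    and x0 :: 'x and blank :: 'g and k :: nat
  assumes aut: "tape_automaton X out tr" and x0: "x0 \<in> X"
    and loc_out: "\<And>x. x \<in> X \<Longrightarrow> obsloc k (out x)" and loc_tr: "\<And>x a. x \<in> X \<Longrightarrow> tloc k (tr x a)"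
begin

text \<open>Fixing the cells beyond the radius leaves finitely many windows, so a window can be part
  of a control state.\<close>

definition win :: "'g tape \<Rightarrow> bool" where
  "win w \<longleftrightarrow> (\<forall>j. \<bar>j\<bar> > int k \<longrightarrow> w j = blank)"

definition nthb :: "'g list \<Rightarrow> int \<Rightarrow> 'g" where
  "nthb xs j = (if 0 \<le> j \<and> j < int (length xs) then xs ! nat j else blank)"

text \<open>Each stack has the cell adjacent to the window on top: l lists leftwards, r rightwards.
  Beyond the stacks the tape is blank.\<close>

definition glue :: "'g tape \<Rightarrow> 'g list \<Rightarrow> 'g list \<Rightarrow> 'g tape" where
  "glue w l r = (\<lambda>j. if j < - int k then nthb l (- int k - 1 - j)
     else if int k < j then nthb r (j - int k - 1) else w j)"

definition move :: "'x \<Rightarrow> 'g tape \<Rightarrow> int \<Rightarrow> ('x, 'g) ctl" where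
  "move x w d = (if d = 0 then Run x w else Shift x w d)"

definition local_step :: "'x \<Rightarrow> 'g tape \<Rightarrow> 'a option \<Rightarrow> ('x, 'g) ctl" where
  "local_step x w a = (case tr x a 0 w of (x', d, w') \<Rightarrow> move x' w' d)"

definition cell_of :: "('a, 'g) sym option \<Rightarrow> 'g" where
  "cell_of t = (case t of None \<Rightarrow> blank | Some s \<Rightarrow> projl (projr s))"

definition slide_right :: "'g tape \<Rightarrow> 'g \<Rightarrow> 'g tape" where
  "slide_right w c = (\<lambda>j. if \<bar>j\<bar> \<le> int k then if j = int k then c else w (j + 1) else blank)"

definition slide_left :: "'g tape \<Rightarrow> 'g \<Rightarrow> 'g tape" where
  "slide_left w c = (\<lambda>j. if \<bar>j\<bar> \<le> int k then if j = - int k then c else w (j - 1) else blank)"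

text \<open>The choice executed last lies on top of \<open>Used\<close> and is the lowest digit. In
  \<open>Incr\<close>, \<open>True\<close> (digit 2) becomes \<open>False\<close> (digit 1) with a
  carry; where the carry stops, \<open>bit (t \<noteq> None)\<close> turns \<open>False\<close> into
  \<open>True\<close> or, on an empty stack, adds the new digit \<open>False\<close>.\<close>

fun prog :: "(('x, 'g) ctl, stk, ('a, 'g) sym) prog" where
  "prog ClrLft = Some (Lft, \<lambda>t. (if t = None then ClrRgt else ClrLft, None))"
| "prog ClrRgt = Some (Rgt, \<lambda>t. (if t = None then Restore else ClrRgt, None))"
| "prog Restore = Some (Done, \<lambda>t. case t of None \<Rightarrow> (Incr, None) | Some s \<Rightarrow> (Restore, Some (Input, s)))"
| "prog Incr = Some (Used, \<lambda>t. if t = Some (bit True) then (Incr, Some (Choices, bit False))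
     else (Rewind, Some (Choices, bit (t \<noteq> None))))"
| "prog Rewind = Some (Used, \<lambda>t. case t of None \<Rightarrow> (Run x0 (\<lambda>_. blank), None)
     | Some s \<Rightarrow> (Rewind, Some (Choices, s)))"
| "prog (Run x w) = Some (Choices, \<lambda>t. case t of None \<Rightarrow> (Check x w, None)
     | Some s \<Rightarrow> (if s = bit True then Feed x w else local_step x w None, Some (Used, s)))"
| "prog (Feed x w) = Some (Input, \<lambda>t. case t of None \<Rightarrow> (Run x w, None)
     | Some s \<Rightarrow> (local_step x w (Some (projl s)), Some (Done, s)))"
| "prog (Shift x w d) = (if 0 < d
     then Some (Rgt, \<lambda>t. (move x (slide_right w (cell_of t)) (d - 1), Some (Lft, tcell (w (- int k)))))
     else Some (Lft, \<lambda>t. (move x (slide_left w (cell_of t)) (d + 1), Some (Rgt, tcell (w (int k))))))"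
| "prog (Check x w) = Some (Input, \<lambda>t. case t of None \<Rightarrow> (if out x 0 w then Acc else ClrLft, None)
     | Some s \<Rightarrow> (ClrLft, Some (Input, s)))"
| "prog Acc = None"

fun ctl_ok :: "('x, 'g) ctl \<Rightarrow> bool" where
  "ctl_ok (Run x w) = (x \<in> X \<and> win w)"
| "ctl_ok (Feed x w) = (x \<in> X \<and> win w)"
| "ctl_ok (Shift x w d) = (x \<in> X \<and> win w \<and> d \<noteq> 0 \<and> \<bar>d\<bar> \<le> int k)"
| "ctl_ok (Check x w) = (x \<in> X \<and> win w)"
| "ctl_ok _ = True"

lemma finite_win: "finite {w. win w}"
proof (rule finite_subset)
  show "{w. win w} \<subseteq> {w. \<forall>j. (j \<in> {- int k..int k} \<longrightarrow> w j \<in> UNIV) \<and> (j \<notin> {- int k..int k} \<longrightarrow> w j = blank)}"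
    by (auto simp: win_def)
qed (rule finite_set_of_finite_funs; simp)

lemma finite_ctl_ok: "finite {q. ctl_ok q}"
proof (rule finite_subset)
  let ?XW = "X \<times> {w. win w}"
  let ?F = "{ClrLft, ClrRgt, Restore, Incr, Rewind, Acc} \<union> case_prod Run ` ?XW \<union> case_prod Feed ` ?XW
    \<union> case_prod Check ` ?XW \<union> (\<lambda>((x, w), d). Shift x w d) ` (?XW \<times> {- int k..int k})"
  show "{q. ctl_ok q} \<subseteq> ?F"
  proof
    fix q
    assume "q \<in> {q. ctl_ok q}"
    then show "q \<in> ?F" by (cases q) (auto simp: image_iff)
  qed
  have "finite X" using aut by (simp add: tape_automaton_def)
  then show "finite ?F" using finite_win by (intro finite_UnI finite_imageI finite_cartesian_product) auto
qed

lemma tr_state: "x \<in> X \<Longrightarrow> fst (tr x a i s) \<in> X"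
  using aut by (auto simp: tape_automaton_def TX_def)

lemma tlocD:
  assumes "tloc k p" "eq_near i k s s'"
  shows "eq_near i k (snd (snd (p i s))) (snd (snd (p i s')))" "fst (p i s) = fst (p i s')"
    "\<bar>fst (snd (p i s)) - i\<bar> \<le> int k" "eq_far i k (snd (snd (p i s))) s"
    "fst (snd (p i s)) = fst (snd (p i s'))"
  using assms unfolding tloc_def by blast+

lemma tloc_shift:
  assumes "tloc k p"
  shows "snd (snd (p i (shift s j))) = shift (snd (snd (p (i + j) s))) j"
    "fst (p i (shift s j)) = fst (p (i + j) s)" "fst (snd (p i (shift s j))) = fst (snd (p (i + j) s)) - j"
proof -
  have "eq_near i k s s" by (simp add: eq_near_def)
  then show "snd (snd (p i (shift s j))) = shift (snd (snd (p (i + j) s))) j"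
    "fst (p i (shift s j)) = fst (p (i + j) s)" "fst (snd (p i (shift s j))) = fst (snd (p (i + j) s)) - j"
    using assms unfolding tloc_def by blast+
qed

lemma win_step:
  assumes "x \<in> X" "win w" "tr x a 0 w = (x', d, w')"
  shows "x' \<in> X \<and> win w' \<and> \<bar>d\<bar> \<le> int k"
proof -
  have "eq_near 0 k w w" by (simp add: eq_near_def)
  note t = tlocD[OF loc_tr[OF assms(1), of a] this]
  show ?thesis
    using t(3,4) assms tr_state[of x a 0 w] by (auto simp: win_def eq_far_def)
qed

lemma prog_closed: "ctl_ok q \<Longrightarrow> prog q = Some (kk, f) \<Longrightarrow> ctl_ok (fst (f t))"
proof -
  assume ok: "ctl_ok q" "prog q = Some (kk, f)"
  have step: "ctl_ok (local_step x w a)" if "x \<in> X" "win w" for x w a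
    using win_step[OF that, of a] by (auto simp: local_step_def move_def split: prod.splits)
  show ?thesis
    using ok
    by (cases q) (auto split: if_splits option.splits simp: step x0 move_def win_def slide_right_def slide_left_def)
qed

section \<open>Simulating automaton runs on window and stacks\<close>

abbreviation search_reach (infix "\<leadsto>" 50) where
  "c \<leadsto> c' \<equiv> reach (sstep prog) c c'"

text \<open>Shift invariance moves the head to 0; by locality the outcome inside the radius depends
  on the window alone, and the cells in the stacks stay as they are.\<close>

lemma glue_step:
  assumes "x \<in> X" "win w" "glue w l r = shift s i" "tr x a 0 w = (x', d, w')"
  shows "\<exists>s'. tr x a i s = (x', i + d, s') \<and> glue w' l r = shift s' i"
proof -
  have near: "eq_near 0 k (shift s i) w"
    by (auto simp: eq_near_def glue_def simp flip: assms(3))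
  note t = tlocD[OF loc_tr[OF assms(1), of a] near]
  note sh = tloc_shift[OF loc_tr[OF assms(1), of a], of 0 s i]
  have "glue w' l r = snd (snd (tr x a 0 (shift s i)))"
  proof
    fix j
    show "glue w' l r j = snd (snd (tr x a 0 (shift s i))) j"
    proof (cases "\<bar>j\<bar> \<le> int k")
      case True
      then show ?thesis using t(1) assms(4) by (auto simp: eq_near_def glue_def)
    next
      case False
      then have "glue w' l r j = glue w l r j" by (auto simp: glue_def)
      then show ?thesis using t(4) False assms(3) by (auto simp: eq_far_def)
    qed
  qed
  then show ?thesis using t sh assms(4) by (cases "tr x a i s") auto
qed

lemma nthb_Nil [simp]: "nthb [] j = blank"
  unfolding nthb_def by auto

lemma nthb_Cons: "0 \<le> j \<Longrightarrow> nthb (c # cs) j = (if j = 0 then c else nthb cs (j - 1))"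
  by (auto simp: nthb_def nth_Cons' nat_diff_distrib)

lemma nthb_tl: "0 \<le> j \<Longrightarrow> j' = j + 1 \<Longrightarrow> nthb (tl xs) j = nthb xs j'"
  by (cases xs) (auto simp: nthb_Cons)

lemma glue_slide_right:
  "glue (slide_right w (nthb r 0)) (w (- int k) # l) (tl r) = shift (glue w l r) 1"
proof
  fix j
  consider "j < - int k - 1" | "j = - int k - 1" | "- int k \<le> j" "j < int k" | "j = int k" | "int k < j"
    by linarith
  then show "glue (slide_right w (nthb r 0)) (w (- int k) # l) (tl r) j = shift (glue w l r) 1 j"
  proof cases
    case 5
    then show ?thesis
      using nthb_tl[of "j - int k - 1" "j - int k" r] by (simp add: glue_def shift_def)
  qed (auto simp: glue_def slide_right_def shift_def nthb_Cons algebra_simps)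
qed

lemma glue_slide_left:
  "glue (slide_left w (nthb l 0)) (tl l) (w (int k) # r) = shift (glue w l r) (-1)"
proof
  fix j
  consider "j < - int k" | "j = - int k" | "- int k < j" "j \<le> int k" | "j = int k + 1" | "int k + 1 < j"
    by linarith
  then show "glue (slide_left w (nthb l 0)) (tl l) (w (int k) # r) j = shift (glue w l r) (-1) j"
  proof cases
    case 1
    then show ?thesis
      using nthb_tl[of "- int k - 1 - j" "- int k - j" l] by (simp add: glue_def shift_def)
  qed (auto simp: glue_def slide_left_def shift_def nthb_Cons algebra_simps)
qed

lemma cell_of_peek: "cell_of (peek (map tcell xs)) = nthb xs 0"
  by (cases xs) (auto simp: cell_of_def nthb_def)

lemma move_reach:
  assumes "win w" "glue w l r = shift s i"
  shows "\<exists>w' l' r'. win w' \<and> glue w' l' r' = shift s (i + d)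
    \<and> (move x w d, stacks ch us v dn l r) \<leadsto> (Run x w', stacks ch us v dn l' r')"
  using assms
proof (induction "nat \<bar>d\<bar>" arbitrary: d i w l r)
  case 0
  then show ?case by (intro exI[of _ w] exI[of _ l] exI[of _ r]) (simp add: move_def reach_refl)
next
  case (Suc n)
  show ?case
  proof (cases "0 < d")
    case True
    let ?w = "slide_right w (nthb r 0)" and ?l = "w (- int k) # l"
    have "win ?w" by (auto simp: win_def slide_right_def)
    moreover have "glue ?w ?l (tl r) = shift s (i + 1)"
      by (simp add: glue_slide_right Suc.prems shift_shift add.commute)
    moreover have "n = nat \<bar>d - 1\<bar>" using Suc.hyps True by simp
    ultimately obtain w' l' r' where IH: "win w'" "glue w' l' r' = shift s (i + 1 + (d - 1))"
      "(move x ?w (d - 1), stacks ch us v dn ?l (tl r)) \<leadsto> (Run x w', stacks ch us v dn l' r')"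
      using Suc.hyps(1) by blast
    have "sstep prog (move x w d, stacks ch us v dn l r) = (move x ?w (d - 1), stacks ch us v dn ?l (tl r))"
      using True by (simp add: move_def sstep_def cell_of_peek flip: map_tl)
    then have "(move x w d, stacks ch us v dn l r) \<leadsto> (Run x w', stacks ch us v dn l' r')"
      using IH(3) by - (rule reach_step, simp only:)
    moreover have "i + 1 + (d - 1) = i + d" by simp
    ultimately show ?thesis using IH(1,2) by auto
  next
    case False
    let ?w = "slide_left w (nthb l 0)" and ?r = "w (int k) # r"
    have "win ?w" by (auto simp: win_def slide_left_def)
    moreover have "glue ?w (tl l) ?r = shift s (i + -1)"
      using glue_slide_left[of w l r] by (simp add: Suc.prems shift_shift add.commute)
    moreover have "n = nat \<bar>d + 1\<bar>" using Suc.hyps False by simp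
    ultimately obtain w' l' r' where IH: "win w'" "glue w' l' r' = shift s (i + -1 + (d + 1))"
      "(move x ?w (d + 1), stacks ch us v dn (tl l) ?r) \<leadsto> (Run x w', stacks ch us v dn l' r')"
      using Suc.hyps(1) by blast
    have "d \<noteq> 0" using Suc.hyps(2) by auto
    then have "sstep prog (move x w d, stacks ch us v dn l r) = (move x ?w (d + 1), stacks ch us v dn (tl l) ?r)"
      using False by (simp add: move_def sstep_def cell_of_peek flip: map_tl)
    then have "(move x w d, stacks ch us v dn l r) \<leadsto> (Run x w', stacks ch us v dn l' r')"
      using IH(3) by - (rule reach_step, simp only:)
    moreover have "i + -1 + (d + 1) = i + d" by simp
    ultimately show ?thesis using IH(1,2) by auto
  qed
qed

lemma local_step_reach:
  assumes "x \<in> X" "win w" "glue w l r = shift s i" "tstep tr a (x, i, s) = (x', i', s')"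
  shows "x' \<in> X \<and> (\<exists>w' l' r'. win w' \<and> glue w' l' r' = shift s' i'
    \<and> (local_step x w a, stacks ch us v dn l r) \<leadsto> (Run x' w', stacks ch us v dn l' r'))"
proof -
  obtain y d w1 where tr: "tr x a 0 w = (y, d, w1)" by (cases "tr x a 0 w")
  obtain s1 where s1: "tr x a i s = (y, i + d, s1)" "glue w1 l r = shift s1 i"
    using glue_step[OF assms(1-3) tr] by blast
  then have eq: "x' = y" "i' = i + d" "s' = s1" using assms(4) by (auto simp: tstep_def)
  then show ?thesis
    using win_step[OF assms(1,2) tr] move_reach[OF _ s1(2), of d x' ch us v dn]
    by (simp add: local_step_def tr)
qed

text \<open>The word stays recoverable because \<open>rev dn @ v\<close> is invariant, and the
  choices pile up on \<open>Used\<close> in the order in which the increment wants them.\<close>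

lemma run_reach:
  assumes "x \<in> X" "win w" "glue w l r = shift s i" "exec tr bs ((x, i, s), v) = ((x', i', s'), v')"
  shows "x' \<in> X \<and> (\<exists>w' l' r' dn'. win w' \<and> glue w' l' r' = shift s' i' \<and> rev dn' @ v' = rev dn @ v
    \<and> (Run x w, stacks bs us v dn l r) \<leadsto> (Run x' w', stacks [] (rev bs @ us) v' dn' l' r'))"
  using assms
proof (induction bs arbitrary: x w l r s i v dn us)
  case Nil
  then show ?case
    by (intro conjI exI[of _ w] exI[of _ l] exI[of _ r] exI[of _ dn]) (simp_all add: reach_refl)
next
  case (Cons b bs)
  show ?case
  proof (cases b)
    case False
    obtain x1 i1 s1 where c1: "tstep tr None (x, i, s) = (x1, i1, s1)" by (cases "tstep tr None (x, i, s)")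
    have st: "sstep prog (Run x w, stacks (b # bs) us v dn l r) = (local_step x w None, stacks bs (b # us) v dn l r)"
      using False by (simp add: sstep_def)
    obtain w1 l1 r1 where 1: "x1 \<in> X" "win w1" "glue w1 l1 r1 = shift s1 i1"
      "(local_step x w None, stacks bs (b # us) v dn l r) \<leadsto> (Run x1 w1, stacks bs (b # us) v dn l1 r1)"
      using local_step_reach[OF Cons.prems(1-3) c1] by blast
    have ex: "exec tr bs ((x1, i1, s1), v) = ((x', i', s'), v')"
      using Cons.prems(4) False c1 by simp
    from Cons.IH[OF 1(1-3) ex, of dn "b # us"] obtain w' l' r' dn' where 2: "x' \<in> X" "win w'"
      "glue w' l' r' = shift s' i'" "rev dn' @ v' = rev dn @ v"
      "(Run x1 w1, stacks bs (b # us) v dn l1 r1) \<leadsto> (Run x' w', stacks [] (rev (b # bs) @ us) v' dn' l' r')"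
      by auto
    show ?thesis
      using 2 reach_step_eq[OF st reach_trans[OF 1(4) 2(5)]] by blast
  next
    case True
    have st: "sstep prog (Run x w, stacks (b # bs) us v dn l r) = (Feed x w, stacks bs (b # us) v dn l r)"
      using True by (simp add: sstep_def)
    show ?thesis
    proof (cases v)
      case Nil
      have st': "sstep prog (Feed x w, stacks bs (b # us) v dn l r) = (Run x w, stacks bs (b # us) v dn l r)"
        using Nil by (simp add: sstep_def)
      have ex: "exec tr bs ((x, i, s), v) = ((x', i', s'), v')"
        using Cons.prems(4) True Nil by simp
      from Cons.IH[OF Cons.prems(1-3) ex, of dn "b # us"] obtain w' l' r' dn' where 2: "x' \<in> X" "win w'"
        "glue w' l' r' = shift s' i'" "rev dn' @ v' = rev dn @ v"
        "(Run x w, stacks bs (b # us) v dn l r) \<leadsto> (Run x' w', stacks [] (rev (b # bs) @ us) v' dn' l' r')"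
        by auto
      show ?thesis
        using 2 reach_step_eq[OF st reach_step_eq[OF st' 2(5)]] by blast
    next
      case (Cons a u)
      obtain x1 i1 s1 where c1: "tstep tr (Some a) (x, i, s) = (x1, i1, s1)" by (cases "tstep tr (Some a) (x, i, s)")
      have st': "sstep prog (Feed x w, stacks bs (b # us) v dn l r)
          = (local_step x w (Some a), stacks bs (b # us) u (a # dn) l r)"
        using Cons by (simp add: sstep_def)
      obtain w1 l1 r1 where 1: "x1 \<in> X" "win w1" "glue w1 l1 r1 = shift s1 i1"
        "(local_step x w (Some a), stacks bs (b # us) u (a # dn) l r) \<leadsto> (Run x1 w1, stacks bs (b # us) u (a # dn) l1 r1)"
        using local_step_reach[OF Cons.prems(1-3) c1] by blast
      have ex: "exec tr bs ((x1, i1, s1), u) = ((x', i', s'), v')"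
        using Cons.prems(4) True c1 Cons by simp
      from Cons.IH[OF 1(1-3) ex, of "a # dn" "b # us"] obtain w' l' r' dn' where 2: "x' \<in> X" "win w'"
        "glue w' l' r' = shift s' i'" "rev dn' @ v' = rev dn @ v"
        "(Run x1 w1, stacks bs (b # us) u (a # dn) l1 r1) \<leadsto> (Run x' w', stacks [] (rev (b # bs) @ us) v' dn' l' r')"
        using Cons by auto
      show ?thesis
        using 2 reach_step_eq[OF st reach_step_eq[OF st' reach_trans[OF 1(4) 2(5)]]]
        by blast
    qed
  qed
qed

section \<open>Rounds of the search\<close>

lemma clear_left: "(ClrLft, stacks ch us v dn l r) \<leadsto> (ClrRgt, stacks ch us v dn [] r)"
proof (induction l)
  case Nil
  show ?case by (rule reach_step) (simp add: sstep_def reach_refl)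
next
  case (Cons g l)
  then show ?case by - (rule reach_step, simp add: sstep_def)
qed

lemma clear_right: "(ClrRgt, stacks ch us v dn l r) \<leadsto> (Restore, stacks ch us v dn l [])"
proof (induction r)
  case Nil
  show ?case by (rule reach_step) (simp add: sstep_def reach_refl)
next
  case (Cons g r)
  then show ?case by - (rule reach_step, simp add: sstep_def)
qed

lemma restore: "(Restore, stacks ch us v dn l r) \<leadsto> (Incr, stacks ch us (rev dn @ v) [] l r)"
proof (induction dn arbitrary: v)
  case Nil
  show ?case by (rule reach_step) (simp add: sstep_def reach_refl)
next
  case (Cons a dn)
  show ?case using Cons[of "a # v"] by - (rule reach_step, simp add: sstep_def)
qed

lemma rewind_choices:
  "(Rewind, stacks ch us v dn l r) \<leadsto> (Run x0 (\<lambda>_. blank), stacks (rev us @ ch) [] v dn l r)"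
proof (induction us arbitrary: ch)
  case Nil
  show ?case by (rule reach_step) (simp add: sstep_def reach_refl)
next
  case (Cons b us)
  show ?case using Cons[of "b # ch"] by - (rule reach_step, simp add: sstep_def)
qed

lemma increment:
  "(Incr, stacks ch us v dn l r) \<leadsto> (Run x0 (\<lambda>_. blank), stacks (rev (succ_str us) @ ch) [] v dn l r)"
proof (induction us arbitrary: ch rule: succ_str.induct)
  case 1
  show ?case using rewind_choices[of "False # ch" "[]"] by - (rule reach_step, simp add: sstep_def)
next
  case (2 us)
  show ?case using 2[of "False # ch"] by - (rule reach_step, simp add: sstep_def)
next
  case (3 us)
  show ?case using rewind_choices[of "True # ch" us] by - (rule reach_step, simp add: sstep_def)
qed

text \<open>The start of the round after the one that tried the choice string \<open>rev us\<close>.\<close>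
definition round :: "'a list \<Rightarrow> bool list \<Rightarrow> ('x, 'g) ctl \<times> (stk \<Rightarrow> ('a, 'g) sym list) \<Rightarrow> bool" where
  "round u us c \<longleftrightarrow> (\<exists>v dn l r. c = (ClrLft, stacks [] us v dn l r) \<and> rev dn @ v = u)"

definition good :: "'a list \<Rightarrow> bool list \<Rightarrow> bool" where
  "good u us \<longleftrightarrow> accepting out (exec tr (rev us) ((x0, 0, \<lambda>_. blank), u))"

text \<open>Both alternatives start from \<open>sstep prog c\<close> to supply the progress required
  by \<open>simulation_halts\<close>. A round always ends because its choice string is
  finite.\<close>

lemma round_reach:
  assumes "round u us c"
  shows "if good u (succ_str us) then \<exists>st. sstep prog c \<leadsto> (Acc, st)
    else \<exists>c'. sstep prog c \<leadsto> c' \<and> round u (succ_str us) c'"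
proof -
  obtain v dn l r where c: "c = (ClrLft, stacks [] us v dn l r)" "rev dn @ v = u"
    using assms by (auto simp: round_def)
  let ?w = "\<lambda>_ :: int. blank" and ?bs = "rev (succ_str us)"
  have 1: "sstep prog c \<leadsto> (ClrRgt, stacks [] us v dn [] r)"
  proof (cases l)
    case Nil
    then show ?thesis by (simp add: c sstep_def reach_refl)
  next
    case (Cons g l')
    then show ?thesis using clear_left[of "[]" us v dn l' r] by (simp add: c sstep_def)
  qed
  have 2: "sstep prog c \<leadsto> (Run x0 ?w, stacks ?bs [] u [] [] [])"
    using reach_trans[OF reach_trans[OF reach_trans[OF 1 clear_right] restore] increment] c by simp
  obtain x' i' s' v' where ex: "exec tr ?bs ((x0, 0, ?w), u) = ((x', i', s'), v')"
    by (metis prod.collapse)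
  have "win ?w" "glue ?w [] [] = shift ?w 0" by (auto simp: win_def glue_def shift_def)
  from run_reach[OF x0 this ex, of "[]" "[]"] obtain w' l' r' dn' where 3: "x' \<in> X" "win w'"
    "glue w' l' r' = shift s' i'" "rev dn' @ v' = u"
    "(Run x0 ?w, stacks ?bs [] u [] [] []) \<leadsto> (Run x' w', stacks [] (succ_str us) v' dn' l' r')"
    by auto
  have st: "sstep prog (Run x' w', stacks [] (succ_str us) v' dn' l' r') = (Check x' w', stacks [] (succ_str us) v' dn' l' r')"
    by (simp add: sstep_def)
  have 4: "sstep prog c \<leadsto> (Check x' w', stacks [] (succ_str us) v' dn' l' r')"
    by (rule reach_trans[OF 2 reach_trans[OF 3(5) reach_one[of "sstep prog", OF st]]])
  \<comment> \<open>Locality and shift invariance of the output map let \<open>Check\<close>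
    evaluate it on the window at position 0.\<close>
  have "eq_near 0 k (shift s' i') w'"
    by (auto simp: eq_near_def glue_def simp flip: 3(3))
  then have out: "out x' i' s' = out x' 0 w'"
    using loc_out[OF 3(1)] by (metis obsloc_def add_0)
  have st': "sstep prog (Check x' w', stacks [] (succ_str us) v' dn' l' r')
      = (if good u (succ_str us) then Acc else ClrLft, stacks [] (succ_str us) v' dn' l' r')"
    by (cases v') (auto simp: sstep_def good_def ex accepting_def out)
  have "sstep prog c \<leadsto> (if good u (succ_str us) then Acc else ClrLft, stacks [] (succ_str us) v' dn' l' r')"
    by (rule reach_trans[OF 4 reach_one[of "sstep prog", OF st']])
  moreover have "round u (succ_str us) (ClrLft, stacks [] (succ_str us) v' dn' l' r')"
    using 3(4) unfolding round_def by blast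
  ultimately show ?thesis by (cases "good u (succ_str us)") (simp only: if_True if_False, blast)+
qed

lemma sstep_final: "sfinal prog c \<Longrightarrow> sstep prog c = c"
  by (auto simp: sfinal_def sstep_def)

text \<open>The abstract machine being simulated is \<open>succ_str\<close>, stopped at a good
  string. A round tests the successor of us, hence \<open>Suc n\<close>.\<close>

lemma search_halts:
  assumes "round u us c"
  shows "halts (sstep prog) (sfinal prog) c \<longleftrightarrow> (\<exists>n. good u ((succ_str ^^ Suc n) us))"
proof -
  define R where "R bs c \<longleftrightarrow> (if good u bs then \<exists>st. c = (Acc, st) else round u bs c)" for bs c
  have next_R: "\<exists>d'. sstep prog d \<leadsto> d' \<and> R (succ_str bs) d'" if "round u bs d" for bs d
    using round_reach[OF that] by (auto simp: R_def split: if_splits)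
  obtain d where d: "sstep prog c \<leadsto> d" "R (succ_str us) d" using next_R[OF assms] by blast
  have "halts succ_str (good u) (succ_str us) \<longleftrightarrow> halts (sstep prog) (sfinal prog) d"
  proof (rule simulation_halts[where R = R])
    show "good u bs \<longleftrightarrow> sfinal prog d" if "R bs d" for bs d
      using that by (auto simp: R_def sfinal_def round_def split: if_splits)
    show "\<exists>d'. sstep prog d \<leadsto> d' \<and> R (succ_str bs) d'" if "R bs d" "\<not> good u bs" for bs d
      using that next_R by (simp add: R_def)
  qed (use d sstep_final in auto)
  then show ?thesis
    using halts_reach[OF sstep_final reach_step[OF d(1)]] by (simp add: halts_def funpow_swap1)
qed

text \<open>The machine starts as if the empty choice string had just been tried with the whole word
  consumed: \<open>Done\<close> then holds the reversed word, as \<open>RE_stack\<close>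
  prescribes.\<close>

lemma recognises:
  "halts (sstep prog) (sfinal prog) (ClrLft, \<lambda>s. if s = Done then rev (map letter w) else [])
    \<longleftrightarrow> obs_sem out tr w x0 0 (\<lambda>_. blank)"
proof -
  let ?st = "\<lambda>s. if s = Done then rev (map letter w) else []"
  have "?st = stacks [] [] [] (rev w) [] []"
  proof
    fix s
    show "?st s = stacks [] [] [] (rev w) [] [] s" by (cases s) (auto simp: rev_map)
  qed
  then have "round w [] (ClrLft, ?st)" unfolding round_def by fastforce
  from search_halts[OF this]
  have "halts (sstep prog) (sfinal prog) (ClrLft, ?st) \<longleftrightarrow> (\<exists>n. good w ((succ_str ^^ Suc n) []))" .
  also have "\<dots> \<longleftrightarrow> (\<exists>bs. accepting out (exec tr bs ((x0, 0, \<lambda>_. blank), w)))"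
  proof
    assume "\<exists>n. good w ((succ_str ^^ Suc n) [])"
    then show "\<exists>bs. accepting out (exec tr bs ((x0, 0, \<lambda>_. blank), w))" unfolding good_def by blast
  next
    assume "\<exists>bs. accepting out (exec tr bs ((x0, 0, \<lambda>_. blank), w))"
    then obtain bs where bs: "accepting out (exec tr bs ((x0, 0, \<lambda>_. blank), w))" by blast
    obtain c where c: "exec tr bs ((x0, 0, \<lambda>_. blank), w) = (c, [])"
      using bs by (cases "exec tr bs ((x0, 0, \<lambda>_. blank), w)") (auto simp: accepting_def)
    \<comment> \<open>On exhausted input \<open>True\<close> does nothing, so appending it makes the
      accepting string nonempty, and the search meets it although it skips the empty string.\<close>
    then have "accepting out (exec tr (bs @ [True]) ((x0, 0, \<lambda>_. blank), w))"
      using bs by (simp add: exec_append)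
    then have "good w (True # rev bs)" by (simp add: good_def)
    then show "\<exists>n. good w ((succ_str ^^ Suc n) [])" using succ_str_surj by (metis list.distinct(1))
  qed
  finally show ?thesis unfolding obs_sem_iff .
qed

end

lemma tape_automaton_imp_RE:
  fixes tr :: "'x \<Rightarrow> ('a::finite) option \<Rightarrow> ('x, 'g::finite) tcomp"
  assumes "tape_automaton X out tr" "x \<in> X"
  shows "RE {w. obs_sem out tr w x 0 (\<lambda>_. blank)}"
proof -
  obtain k where "\<And>x. x \<in> X \<Longrightarrow> obsloc k (out x)" "\<And>x a. x \<in> X \<Longrightarrow> tloc k (tr x a)"
    using uniform_radius[OF assms(1)] by blast
  then interpret search X out tr x blank k
    using assms by unfold_locales
  have "RE {w. halts (sstep prog) (sfinal prog) (ClrLft, \<lambda>s. if s = Done then rev (map letter w) else [])}"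
    by (rule RE_stack[OF finite_ctl_ok]) (use prog_closed in auto)
  then show ?thesis by (simp add: recognises)
qed

section \<open>Recursively enumerable languages are accepted by tape automata\<close>

text \<open>A machine symbol occupies a block of \<open>b\<close> cells; \<open>i div b\<close> is the index of the block containing
  cell \<open>i\<close>.\<close>
locale block_code =
  fixes \<Sigma> :: "'s set" and code :: "'s \<Rightarrow> int \<Rightarrow> 'g" and b :: int
  assumes b_pos: "0 < b"
    and code_inj: "\<And>s s'. s \<in> \<Sigma> \<Longrightarrow> s' \<in> \<Sigma> \<Longrightarrow> (\<And>m. 0 \<le> m \<Longrightarrow> m < b \<Longrightarrow> code s m = code s' m) \<Longrightarrow> s = s'"
begin

text \<open>On a block that codes no symbol the value is arbitrary, but it still depends on the b
  cells alone; locality is required on all tapes, not only on encodings.\<close>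

definition decode :: "'g tape \<Rightarrow> 's" where
  "decode t = (SOME s. s \<in> \<Sigma> \<and> (\<forall>m. 0 \<le> m \<longrightarrow> m < b \<longrightarrow> t m = code s m))"

definition write_block :: "int \<Rightarrow> 's \<Rightarrow> 'g tape \<Rightarrow> 'g tape" where
  "write_block i s t = (\<lambda>j. if i \<le> j \<and> j < i + b then code s (j - i) else t j)"

definition enc :: "(int \<Rightarrow> 's) \<Rightarrow> 'g tape" where
  "enc tp = (\<lambda>j. code (tp (j div b)) (j mod b))"

text \<open>The block is taken to start at the head, since shift invariance forbids any reference to
  absolute positions; in the simulation the head always stands at a multiple of b.\<close>

definition act :: "('s \<Rightarrow> 'x \<times> 's \<times> int) \<Rightarrow> ('x, 'g) tcomp" where
  "act F = (\<lambda>i t. case F (decode (shift t i)) of (x, s, d) \<Rightarrow> (x, i + b * d, write_block i s t))"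

lemma decode_cong:
  assumes "\<And>m. 0 \<le> m \<Longrightarrow> m < b \<Longrightarrow> t m = t' m"
  shows "decode t = decode t'"
proof -
  have "(\<lambda>s. s \<in> \<Sigma> \<and> (\<forall>m. 0 \<le> m \<longrightarrow> m < b \<longrightarrow> t m = code s m))
      = (\<lambda>s. s \<in> \<Sigma> \<and> (\<forall>m. 0 \<le> m \<longrightarrow> m < b \<longrightarrow> t' m = code s m))"
    using assms by (auto simp: fun_eq_iff)
  then show ?thesis unfolding decode_def by simp
qed

lemma block_div: "b * h \<le> j \<and> j < b * h + b \<longleftrightarrow> j div b = h"
proof
  assume "b * h \<le> j \<and> j < b * h + b"
  then show "j div b = h"
    by (intro int_div_pos_eq[of _ _ _ "j - b * h"]) auto
next
  assume "j div b = h"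
  then have "b * h + j mod b = j" by (metis mult_div_mod_eq)
  then show "b * h \<le> j \<and> j < b * h + b"
    using pos_mod_bound[OF b_pos, of j] pos_mod_sign[OF b_pos, of j] by linarith
qed

lemma decode_enc:
  assumes "tp h \<in> \<Sigma>"
  shows "decode (shift (enc tp) (b * h)) = tp h"
proof -
  have eq: "shift (enc tp) (b * h) m = code (tp h) m" if "0 \<le> m" "m < b" for m
    using that by (simp add: shift_def enc_def)
  show ?thesis
    unfolding decode_def
  proof (rule some_equality)
    show "tp h \<in> \<Sigma> \<and> (\<forall>m. 0 \<le> m \<longrightarrow> m < b \<longrightarrow> shift (enc tp) (b * h) m = code (tp h) m)"
      using assms eq by blast
    fix s
    assume "s \<in> \<Sigma> \<and> (\<forall>m. 0 \<le> m \<longrightarrow> m < b \<longrightarrow> shift (enc tp) (b * h) m = code s m)"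
    then show "s = tp h" using assms eq code_inj[of s "tp h"] by simp
  qed
qed

lemma write_enc: "write_block (b * h) s (enc tp) = enc (tp(h := s))"
proof
  fix j
  have "j - b * h = j mod b" if "j div b = h"
    using that by (simp add: minus_mult_div_eq_mod flip: that)
  then show "write_block (b * h) s (enc tp) j = enc (tp(h := s)) j"
    by (simp add: write_block_def enc_def block_div)
qed

lemma act_enc:
  assumes "tp h \<in> \<Sigma>"
  shows "act F (b * h) (enc tp) = (case F (tp h) of (x, s, d) \<Rightarrow> (x, b * (h + d), enc (tp(h := s))))"
  by (simp add: act_def decode_enc[of tp, OF assms] write_enc distrib_left case_prod_beta)

lemma decode_near:
  assumes "eq_near i (nat b) t t'"
  shows "decode (shift t i) = decode (shift t' i)"
  using assms b_pos by (intro decode_cong) (auto simp: eq_near_def shift_def)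

text \<open>Only the b cells from the head onwards are read or written, and the head moves by at
  most one block, so b is a radius.\<close>

lemma act_tloc:
  assumes "\<And>s. \<bar>snd (snd (F s))\<bar> \<le> 1"
  shows "tloc (nat b) (act F)"
  unfolding tloc_def
proof (intro allI impI)
  fix i j :: int and t t' :: "'g tape"
  assume near: "eq_near i (nat b) t t'"
  obtain x s d where F: "F (decode (shift t i)) = (x, s, d)" by (cases "F (decode (shift t i))")
  obtain x' s' d' where F': "F (decode (shift t (i + j))) = (x', s', d')" by (cases "F (decode (shift t (i + j)))")
  have "\<bar>d\<bar> \<le> 1" using assms[of "decode (shift t i)"] F by simp
  then have bd: "\<bar>b * d\<bar> \<le> b" using b_pos by (cases "d = 0 \<or> d = 1 \<or> d = -1") auto
  have write_shift: "write_block i s' (shift t j) = shift (write_block (i + j) s' t) j"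
    by (auto simp: write_block_def shift_def fun_eq_iff algebra_simps)
  have acts: "act F i t = (x, i + b * d, write_block i s t)" "act F i t' = (x, i + b * d, write_block i s t')"
    "act F i (shift t j) = (x', i + b * d', write_block i s' (shift t j))"
    "act F (i + j) t = (x', i + j + b * d', write_block (i + j) s' t)"
    using F F' by (simp_all add: act_def shift_shift flip: decode_near[OF near])
  show "eq_near i (nat b) (snd (snd (act F i t))) (snd (snd (act F i t')))
      \<and> fst (act F i t) = fst (act F i t')
      \<and> \<bar>fst (snd (act F i t)) - i\<bar> \<le> int (nat b)
      \<and> eq_far i (nat b) (snd (snd (act F i t))) t
      \<and> fst (snd (act F i t)) = fst (snd (act F i t'))
      \<and> snd (snd (act F i (shift t j))) = shift (snd (snd (act F (i + j) t))) j
      \<and> fst (act F i (shift t j)) = fst (act F (i + j) t)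
      \<and> fst (snd (act F i (shift t j))) = fst (snd (act F (i + j) t)) - j"
    using near b_pos bd unfolding acts fst_conv snd_conv
    by (intro conjI write_shift) (auto simp: write_block_def eq_near_def eq_far_def)
qed

end

text \<open>A unary code: symbol number n is n copies of a nonblank g followed by blanks, in blocks
  longer than every number in use. Numbering s0 by 0 makes its block blank.\<close>

lemma block_code_exists:
  fixes blank :: "'g::finite" and \<Sigma> :: "'s set"
  assumes "CARD('g) \<ge> 2" "finite \<Sigma>"
  obtains code b where "block_code \<Sigma> code b" "\<And>m. 0 \<le> m \<Longrightarrow> code s0 m = blank"
proof -
  obtain f :: "'s \<Rightarrow> nat" where f: "inj_on f \<Sigma>" "f s0 = 0"
    using finite_inj_nat_pointed[OF assms(2)] by metis
  have "\<not> (UNIV :: 'g set) \<subseteq> {blank}"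
    using assms(1) card_mono[of "{blank}" "UNIV :: 'g set"] by auto
  then obtain g where g: "g \<noteq> blank" by blast
  show ?thesis
  proof
    let ?code = "\<lambda>s m. if m < int (f s) then g else blank"
    let ?b = "int (Suc (Max (f ` \<Sigma>)))"
    show "block_code \<Sigma> ?code ?b"
    proof
      fix s s'
      assume s: "s \<in> \<Sigma>" "s' \<in> \<Sigma>" and eq: "\<And>m. 0 \<le> m \<Longrightarrow> m < ?b \<Longrightarrow> ?code s m = ?code s' m"
      have "f s < Suc (Max (f ` \<Sigma>))" "f s' < Suc (Max (f ` \<Sigma>))" using s assms(2) by (auto simp: less_Suc_eq_le)
      \<comment> \<open>If the numbers differed, the codes would differ at the position given by the
        smaller one.\<close>
      then have "f s = f s'"
        using eq[of "int (f s)"] eq[of "int (f s')"] g by (auto split: if_splits)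
      then show "s = s'" using f(1) s by (auto dest: inj_onD)
    qed simp
    show "?code s0 m = blank" if "0 \<le> m" for m using f(2) that by simp
  qed
qed

text \<open>State 0 reads and stores the input, state 1 rewinds to the blank block left of it, state 2
  rejects, and state \<open>q + 3\<close> simulates state \<open>q\<close>.\<close>
fun sim_rule :: "'a tm \<Rightarrow> nat \<Rightarrow> 'a option \<Rightarrow> 'a + nat \<Rightarrow> nat \<times> ('a + nat) \<times> int" where
  "sim_rule \<delta> 0 (Some a) s = (0, Inl a, 1)"
| "sim_rule \<delta> 0 None s = (1, s, -1)"
| "sim_rule \<delta> (Suc 0) None s = (if s = Inr 0 then (3, s, 1) else (1, s, -1))"
| "sim_rule \<delta> (Suc (Suc (Suc q))) None s =
    (case \<delta> q s of None \<Rightarrow> (q + 3, s, 0) | Some (q', s', d) \<Rightarrow> (q' + 3, s', d))"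
| "sim_rule \<delta> _ _ s = (2, s, 0)"

text \<open>The parameter u is the input consumed so far. The bound -1 in the rewinding case is the
  blank just left of the input.\<close>

definition sim_inv :: "'a tm \<Rightarrow> 'a list \<Rightarrow> nat \<Rightarrow> int \<Rightarrow> (int \<Rightarrow> 'a + nat) \<Rightarrow> bool" where
  "sim_inv \<delta> u x h tp \<longleftrightarrow>
     x = 0 \<and> h = int (length u) \<and> tp = tm_input u
   \<or> x = 1 \<and> -1 \<le> h \<and> h < int (length u) \<and> tp = tm_input u
   \<or> (\<exists>q n. x = q + 3 \<and> (tm_step \<delta> ^^ n) (0, 0, tm_input u) = (q, h, tp))"

lemma tm_input_snoc: "(tm_input u)(int (length u) := Inl a) = tm_input (u @ [a])"
  by (auto simp: tm_input_def fun_eq_iff nth_append)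

text \<open>On a halting configuration both sides stand still: the rule rewrites the scanned symbol
  and does not move.\<close>

lemma sim_rule_sim:
  "sim_rule \<delta> (q + 3) None (tp h) = (x, s, d) \<Longrightarrow>
     \<exists>q'. x = q' + 3 \<and> tm_step \<delta> (q, h, tp) = (q', h + d, tp(h := s))"
  by (auto simp: tm_step_def numeral_eq_Suc split: option.splits)

lemma sim_inv_tau:
  assumes "sim_inv \<delta> u x h tp" "sim_rule \<delta> x None (tp h) = (x', s, d)"
  shows "sim_inv \<delta> u x' (h + d) (tp(h := s))"
proof -
  consider "x = 0" "h = int (length u)" "tp = tm_input u"
    | "x = 1" "-1 \<le> h" "h < int (length u)" "tp = tm_input u"
    | q n where "x = q + 3" "(tm_step \<delta> ^^ n) (0, 0, tm_input u) = (q, h, tp)"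
    using assms(1) by (auto simp: sim_inv_def)
  then show ?thesis
  proof cases
    case 1
    then show ?thesis using assms(2) by (auto simp: sim_inv_def)
  next
    case 2
    show ?thesis
    proof (cases "h = -1")
      case True
      then have "x' = 3" "s = tp h" "d = 1"
        using 2 assms(2) by (auto simp: tm_input_def)
      then show ?thesis using 2 True unfolding sim_inv_def
        by (intro disjI2 exI[of _ 0] exI[of _ 0]) simp
    next
      \<comment> \<open>The scanned cell lies inside the input and holds a letter, so it cannot be
        mistaken for the blank at -1.\<close>
      case False
      then have "x' = 1" "s = tp h" "d = -1"
        using 2 assms(2) by (auto simp: tm_input_def)
      then show ?thesis using 2 False by (auto simp: sim_inv_def)
    qed
  next
    case 3
    then obtain q' where "x' = q' + 3" "tm_step \<delta> (q, h, tp) = (q', h + d, tp(h := s))"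
      using assms(2) sim_rule_sim by blast
    then have "x' = q' + 3 \<and> (tm_step \<delta> ^^ Suc n) (0, 0, tm_input u) = (q', h + d, tp(h := s))"
      using 3 by simp
    then show ?thesis unfolding sim_inv_def by blast
  qed
qed

lemma sim_inv_letter:
  assumes "sim_inv \<delta> u x h tp" "sim_rule \<delta> x (Some a) (tp h) = (x', s, d)"
  shows "x' = 2 \<or> sim_inv \<delta> (u @ [a]) x' (h + d) (tp(h := s))"
proof -
  consider "x = 0" "h = int (length u)" "tp = tm_input u"
    | "x = Suc 0" | q where "x = Suc (Suc (Suc q))"
    using assms(1) by (auto simp: sim_inv_def numeral_eq_Suc)
  then show ?thesis
    using assms(2) by cases (auto simp: sim_inv_def tm_input_snoc)
qed

section \<open>The simulating automaton and its correctness\<close>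

locale tm_sim = block_code "range Inl \<union> Inr ` {..S}" code b
  for S :: nat and code :: "('a::finite) + nat \<Rightarrow> int \<Rightarrow> 'g" and b +
  fixes Q :: nat and \<delta> :: "'a tm" and blank :: 'g
  assumes wf: "tm_wf Q S \<delta>" and code_blank: "\<And>m. 0 \<le> m \<Longrightarrow> code (Inr 0) m = blank"
begin

definition sim_tr :: "nat \<Rightarrow> 'a option \<Rightarrow> (nat, 'g) tcomp" where
  "sim_tr x a = act (sim_rule \<delta> x a)"

definition sim_out :: "nat \<Rightarrow> 'g obs" where
  "sim_out x = (\<lambda>i t. 3 \<le> x \<and> \<delta> (x - 3) (decode (shift t i)) = None)"

text \<open>States and moves are bounded for every s because decoding an ill-formed block may
  produce any symbol. Only the alphabet condition on s' presupposes a proper s, which several rules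
  write back.\<close>

lemma sim_rule_bounds:
  assumes "x < Q + 3" "sim_rule \<delta> x a s = (x', s', d)"
  shows "x' < Q + 3 \<and> \<bar>d\<bar> \<le> 1 \<and> (s \<in> range Inl \<union> Inr ` {..S} \<longrightarrow> s' \<in> range Inl \<union> Inr ` {..S})"
proof -
  have wf': "q' < Q \<and> s' \<in> range Inl \<union> Inr ` {..S} \<and> d \<in> {-1, 0, 1}"
    if "q < Q" "\<delta> q s = Some (q', s', d)" for q s q' s' d
    using wf that unfolding tm_wf_def by blast
  have "0 < Q" using wf by (simp add: tm_wf_def)
  then show ?thesis
    using assms
    by (cases "(\<delta>, x, a, s)" rule: sim_rule.cases)
      (auto split: if_splits option.splits dest: wf')
qed

lemma sim_automaton: "tape_automaton {..<Q + 3} sim_out sim_tr"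
  unfolding tape_automaton_def
proof (intro conjI ballI allI)
  fix x a
  assume x: "x \<in> {..<Q + 3}"
  show "sim_out x \<in> Bset"
    unfolding Bset_obsloc
  proof
    show "obsloc (nat b) (sim_out x)"
      using decode_near by (fastforce simp: obsloc_def sim_out_def shift_shift)
  qed
  have "tloc (nat b) (sim_tr x a)"
    unfolding sim_tr_def
    by (rule act_tloc) (use x sim_rule_bounds in \<open>metis lessThan_iff prod.collapse\<close>)
  moreover have "fst (sim_tr x a i s) \<in> {..<Q + 3}" for i s
    using x sim_rule_bounds[of x a "decode (shift s i)"]
    by (cases "sim_rule \<delta> x a (decode (shift s i))") (auto simp: sim_tr_def act_def)
  ultimately show "sim_tr x a \<in> TX {..<Q + 3}" by (auto simp: TX_def)
qed simp

abbreviation valid :: "nat \<Rightarrow> (int \<Rightarrow> 'a + nat) \<Rightarrow> bool" where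
  "valid x tp \<equiv> x < Q + 3 \<and> (\<forall>h. tp h \<in> range Inl \<union> Inr ` {..S})"

lemma sim_step:
  assumes "valid x tp" "sim_rule \<delta> x a (tp h) = (x', s, d)"
  shows "tstep sim_tr a (x, b * h, enc tp) = (x', b * (h + d), enc (tp(h := s))) \<and> valid x' (tp(h := s))"
proof -
  have "tp h \<in> range Inl \<union> Inr ` {..S}" using assms by blast
  then show ?thesis
    using assms sim_rule_bounds[of x a "tp h"] by (auto simp: tstep_def sim_tr_def act_enc)
qed

text \<open>In the absorbing state 2 nothing needs to be remembered; elsewhere the tape encodes a
  stage of the simulation on the prefix u consumed so far.\<close>

definition config_inv :: "'a list \<Rightarrow> (nat \<times> int \<times> 'g tape) \<times> 'a list \<Rightarrow> bool" where
  "config_inv w = (\<lambda>((x, i, t), v). x = 2 \<or>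
     (\<exists>u h tp. w = u @ v \<and> i = b * h \<and> t = enc tp \<and> valid x tp \<and> sim_inv \<delta> u x h tp))"

lemma config_invI:
  "x = 2 \<or> w = u @ v \<and> valid x tp \<and> sim_inv \<delta> u x h tp \<Longrightarrow> config_inv w ((x, b * h, enc tp), v)"
  unfolding config_inv_def by blast

lemma reject_step: "fst (tstep sim_tr a (2, i, t)) = 2"
  by (cases a) (simp_all add: tstep_def sim_tr_def act_def numeral_eq_Suc)

lemma config_inv_tau:
  assumes "config_inv w (c, v)"
  shows "config_inv w (tstep sim_tr None c, v)"
proof (cases "fst c = 2")
  case True
  then show ?thesis using reject_step[of None] by (cases c) (auto simp: config_inv_def case_prod_beta)
next
  case False
  obtain x i t where c: "c = (x, i, t)" by (cases c)
  then obtain u h tp where i: "w = u @ v" "i = b * h" "t = enc tp" "valid x tp" "sim_inv \<delta> u x h tp"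
    using assms False by (auto simp: config_inv_def)
  obtain x' s d where r: "sim_rule \<delta> x None (tp h) = (x', s, d)" by (cases "sim_rule \<delta> x None (tp h)")
  show ?thesis
    using sim_step[OF i(4) r] sim_inv_tau[OF i(5) r] i
      config_invI[of x' w u v "tp(h := s)" "h + d"] by (simp add: c)
qed

lemma config_inv_letter:
  assumes "config_inv w (c, a # v)"
  shows "config_inv w (tstep sim_tr (Some a) c, v)"
proof (cases "fst c = 2")
  case True
  then show ?thesis using reject_step[of "Some a"] by (cases c) (auto simp: config_inv_def case_prod_beta)
next
  case False
  obtain x i t where c: "c = (x, i, t)" by (cases c)
  then obtain u h tp where i: "w = u @ a # v" "i = b * h" "t = enc tp" "valid x tp" "sim_inv \<delta> u x h tp"
    using assms False by (auto simp: config_inv_def)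
  obtain x' s d where r: "sim_rule \<delta> x (Some a) (tp h) = (x', s, d)"
    by (cases "sim_rule \<delta> x (Some a) (tp h)")
  show ?thesis
    using sim_step[OF i(4) r] sim_inv_letter[OF i(5) r] i
      config_invI[of x' w "u @ [a]" v "tp(h := s)" "h + d"] by (simp add: c)
qed

lemma exec_config_inv: "config_inv w cv \<Longrightarrow> config_inv w (exec sim_tr bs cv)"
  by (induction sim_tr bs cv rule: exec.induct) (auto dest: config_inv_tau config_inv_letter)

lemma valid_input: "valid 0 (tm_input u)"
  by (auto simp: tm_input_def)

lemma enc_blank: "enc (tm_input []) = (\<lambda>_. blank)"
  using b_pos code_blank by (auto simp: enc_def tm_input_def fun_eq_iff)

lemma read_input:
  "exec sim_tr (replicate (length v) True) ((0, b * int (length u), enc (tm_input u)), v)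
   = ((0, b * int (length (u @ v)), enc (tm_input (u @ v))), [])"
proof (induction v arbitrary: u)
  case Nil
  then show ?case by simp
next
  case (Cons a v)
  have "tstep sim_tr (Some a) (0, b * int (length u), enc (tm_input u))
      = (0, b * int (length (u @ [a])), enc (tm_input (u @ [a])))"
    using sim_step[OF valid_input[of u], of "Some a" "int (length u)"]
    by (simp add: tm_input_snoc add.commute)
  then show ?case using Cons[of "u @ [a]"] by simp
qed

text \<open>The head block is n - 1, so that the induction starts on the blank block at -1.\<close>

lemma rewind:
  "int n \<le> int (length u) \<Longrightarrow>
    reach (tstep sim_tr None) (1, b * (int n - 1), enc (tm_input u)) (3, 0, enc (tm_input u))"
proof (induction n)
  case 0
  have "tstep sim_tr None (1, b * (int 0 - 1), enc (tm_input u)) = (3, 0, enc (tm_input u))"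
    using sim_step[of 1 "tm_input u" None "-1"] valid_input[of u]
    by (auto simp: tm_input_def fun_upd_idem)
  then show ?case by - (rule reach_step, simp add: reach_refl)
next
  case (Suc n)
  have "tstep sim_tr None (1, b * (int (Suc n) - 1), enc (tm_input u)) = (1, b * (int n - 1), enc (tm_input u))"
    using sim_step[of 1 "tm_input u" None "int n"] valid_input[of u] Suc.prems
    by (auto simp: tm_input_def fun_upd_idem)
  then show ?case using Suc by - (rule reach_step, simp)
qed

lemma sim_reach:
  assumes "(tm_step \<delta> ^^ n) (0, 0, tm_input u) = (q, h, tp)"
  shows "valid (q + 3) tp \<and> reach (tstep sim_tr None) (3, 0, enc (tm_input u)) (q + 3, b * h, enc tp)"
  using assms
proof (induction n arbitrary: q h tp)
  case 0
  then show ?case using valid_input[of u] wf by (auto simp: reach_refl tm_wf_def)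
next
  case (Suc n)
  obtain q0 h0 tp0 where 0: "(tm_step \<delta> ^^ n) (0, 0, tm_input u) = (q0, h0, tp0)"
    by (cases "(tm_step \<delta> ^^ n) (0, 0, tm_input u)")
  note IH = Suc.IH[OF 0]
  obtain x s d where r: "sim_rule \<delta> (q0 + 3) None (tp0 h0) = (x, s, d)"
    by (cases "sim_rule \<delta> (q0 + 3) None (tp0 h0)")
  have "x = q + 3" "h = h0 + d" "tp = tp0(h0 := s)"
    using sim_rule_sim[of \<delta> q0 tp0 h0, OF r] Suc.prems 0 by auto
  then have "tstep sim_tr None (q0 + 3, b * h0, enc tp0) = (q + 3, b * h, enc tp)" "valid (q + 3) tp"
    using sim_step[OF conjunct1[OF IH] r] by auto
  then show ?case
    using reach_trans[OF conjunct2[OF IH] reach_step] reach_refl by metis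
qed

text \<open>Acceptance requires exhausted input and a simulating state; the invariant then makes the
  consumed prefix all of w, so a premature guess of the end of the input cannot lead to
  acceptance.\<close>

lemma sim_accepts: "obs_sem sim_out sim_tr w 0 0 (\<lambda>_. blank) \<longleftrightarrow> tm_halts \<delta> w"
  unfolding obs_sem_iff
proof
  assume "\<exists>bs. accepting sim_out (exec sim_tr bs ((0, 0, \<lambda>_. blank), w))"
  then obtain bs where acc: "accepting sim_out (exec sim_tr bs ((0, 0, \<lambda>_. blank), w))" by blast
  obtain x i t v where e: "exec sim_tr bs ((0, 0, \<lambda>_. blank), w) = ((x, i, t), v)"
    by (metis prod.collapse)
  have "config_inv w ((0, 0, \<lambda>_. blank), w)"
    unfolding config_inv_def using valid_input[of "[]"] enc_blank
    by (auto intro!: exI[of _ 0] exI[of _ "tm_input []"] simp: sim_inv_def)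
  from exec_config_inv[OF this, of bs] have inv: "config_inv w ((x, i, t), v)" by (simp add: e)
  have out: "v = []" "3 \<le> x" "\<delta> (x - 3) (decode (shift t i)) = None"
    using acc by (auto simp: e accepting_def sim_out_def)
  from inv out obtain h tp where i: "i = b * h" "t = enc tp" "valid x tp" "sim_inv \<delta> w x h tp"
    by (auto simp: config_inv_def)
  then obtain n where n: "(tm_step \<delta> ^^ n) (0, 0, tm_input w) = (x - 3, h, tp)"
    using out by (auto simp: sim_inv_def)
  have "tp h \<in> range Inl \<union> Inr ` {..S}" using i by blast
  then have "\<delta> (x - 3) (tp h) = None" using out i by (simp add: decode_enc)
  then show "tm_halts \<delta> w" unfolding tm_halts_def using n by (intro exI[of _ n]) simp
next
  assume "tm_halts \<delta> w"
  then obtain n q h tp where n: "(tm_step \<delta> ^^ n) (0, 0, tm_input w) = (q, h, tp)" "\<delta> q (tp h) = None"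
    by (auto simp: tm_halts_def)
  note sr = sim_reach[OF n(1)]
  have "tstep sim_tr None (0, b * int (length w), enc (tm_input w))
      = (1, b * (int (length w) - 1), enc (tm_input w))"
    using sim_step[OF valid_input[of w], of None "int (length w)"] by simp
  then have "reach (tstep sim_tr None) (0, b * int (length w), enc (tm_input w)) (3, 0, enc (tm_input w))"
    using rewind[of "length w" w] by - (rule reach_step, simp)
  then have "reach (tstep sim_tr None) (0, b * int (length w), enc (tm_input w)) (q + 3, b * h, enc tp)"
    using reach_trans[OF _ conjunct2[OF sr]] by blast
  then obtain m where "(tstep sim_tr None ^^ m) (0, b * int (length w), enc (tm_input w)) = (q + 3, b * h, enc tp)"
    by (auto simp: reach_def)
  \<comment> \<open>The witness reads all letters before any silent step; the m silent steps cover
    the switch to rewinding, the rewinding and the simulation.\<close>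
  then have "exec sim_tr (replicate (length w) True @ replicate m False) ((0, 0, \<lambda>_. blank), w)
      = ((q + 3, b * h, enc tp), [])"
    using read_input[of w "[]"] by (simp add: exec_append exec_replicate_False enc_blank)
  moreover have "tp h \<in> range Inl \<union> Inr ` {..S}" using sr by blast
  ultimately have "accepting sim_out (exec sim_tr (replicate (length w) True @ replicate m False) ((0, 0, \<lambda>_. blank), w))"
    using n by (simp add: accepting_def sim_out_def decode_enc)
  then show "\<exists>bs. accepting sim_out (exec sim_tr bs ((0, 0, \<lambda>_. blank), w))" by blast
qed

end

lemma RE_imp_tape_automaton:
  fixes blank :: "'g::finite" and L :: "('a::finite) list set"
  assumes "CARD('g) \<ge> 2" "RE L"
  shows "\<exists>(X :: nat set) out (tr :: nat \<Rightarrow> 'a option \<Rightarrow> (nat, 'g) tcomp) x.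
    tape_automaton X out tr \<and> x \<in> X \<and> L = {w. obs_sem out tr w x 0 (\<lambda>_. blank)}"
proof -
  obtain Q S \<delta> where wf: "tm_wf Q S \<delta>" and L: "L = {w. tm_halts \<delta> w}"
    using assms(2) by (auto simp: RE_def)
  have "finite (range Inl \<union> Inr ` {..S} :: ('a + nat) set)" by simp
  from block_code_exists[OF assms(1) this, of "Inr 0" blank]
  obtain code b where "block_code (range Inl \<union> Inr ` {..S} :: ('a + nat) set) code b"
    "\<And>m. 0 \<le> m \<Longrightarrow> code (Inr 0) m = blank" by blast
  then interpret tm_sim S code b Q \<delta> blank
    using wf by (simp add: tm_sim_def tm_sim_axioms_def)
  show ?thesis
    using sim_automaton sim_accepts L by (intro exI[of _ "{..<Q + 3}"] exI[of _ sim_out] exI[of _ sim_tr] exI[of _ 0]) simp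
qed

theorem mainTheorem11:
  fixes blank :: "'g::finite"
  assumes "CARD('g) \<ge> 2"
  shows "(\<forall>(X :: 'x set) out (tr :: 'x \<Rightarrow> ('a::finite) option \<Rightarrow> ('x, 'g) tcomp) x.
            tape_automaton X out tr \<and> x \<in> X \<longrightarrow>
            RE {w :: 'a list. obs_sem out tr w x 0 (\<lambda>_. blank)})
       \<and> (\<forall>L :: 'a list set. RE L \<longrightarrow>
            (\<exists>(X :: nat set) out (tr :: nat \<Rightarrow> 'a option \<Rightarrow> (nat, 'g) tcomp) x.
               tape_automaton X out tr \<and> x \<in> X \<and>
               L = {w. obs_sem out tr w x 0 (\<lambda>_. blank)}))"
proof (intro conjI allI impI)
  show "RE {w :: 'a list. obs_sem out tr w x 0 (\<lambda>_. blank)}"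
    if "tape_automaton X out tr \<and> x \<in> X"
    for X :: "'x set" and out and tr :: "'x \<Rightarrow> 'a option \<Rightarrow> ('x, 'g) tcomp" and x
    by (rule tape_automaton_imp_RE) (use that in auto)
  show "\<exists>(X :: nat set) out (tr :: nat \<Rightarrow> 'a option \<Rightarrow> (nat, 'g) tcomp) x.
      tape_automaton X out tr \<and> x \<in> X \<and> L = {w. obs_sem out tr w x 0 (\<lambda>_. blank)}"
    if "RE L" for L :: "'a list set"
    using RE_imp_tape_automaton[OF assms that] .
qed

end
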